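(* Let $\mathcal{G}$ be a minimal, second countable, locally compact Hausdorff étale groupoid whose unit space $\mathcal{G}^{(0)}$ is a Cantor space. Suppose $\mathcal{G}$ has comparison. Then the commutator subgroup $[\mathcal{G}]'$ of the full group $[\mathcal{G}]$ is simple.
   Context: For a topological groupoid $\mathcal{G}$ with unit space $\mathcal{G}^{(0)}$, range map $r$ and source map $s$: $\mathcal{G}$ is étale if $r$ and $s$ are local homeomorphisms. Every étale groupoid is assumed to be locally compact and Hausdorff. A Cantor space is a topological space homeomorphic to the Cantor set. The orbit of $x\in\mathcal{G}^{(0)}$ is $\{r(g): g\in\mathcal{G},\ s(g)=x\}$; $\mathcal{G}$ is minimal if every orbit is dense in $\mathcal{G}^{(0)}$. A subset $U\subseteq\mathcal{G}$ is a bisection if $r|_U$ and $s|_U$ are injective. A regular Borel probability measure $\mu$ on $\mathcal{G}^{(0)}$ is $\mathcal{G}$-invariant if $\mu(s(E))=\mu(r(E))$ for every Borel set $E$ contained in an open bisection; $M(\mathcal{G})$ is the set of all such measures (possibly empty). Comparison: a minimal étale groupoid $\mathcal{G}$ whose unit space is a Cantor space has comparison if for any clopen subsets $A,B$ of $\mathcal{G}^{(0)}$ such that $B\neq\varnothing$ and $\mu(A)<\mu(B)$ for all $\mu\in M(\mathcal{G})$ (a vacuous condition if $M(\mathcal{G})=\varnothing$), there is a compact open bisection $U$ with $s(U)=A$ and $r(U)\subseteq B$. The full group $[\mathcal{G}]$ is the group (under composition) of all homeomorphisms $\alpha$ of $\mathcal{G}^{(0)}$ such that for every $x\in\mathcal{G}^{(0)}$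 there is $g\in\mathcal{G}$ with $s(g)=x$ and $r(g)=\alpha(x)$. For a group $G$, $G'$ denotes its commutator subgroup, generated by the commutators $[a,b]=aba^{-1}b^{-1}$. *)

theory Defs
  imports "HOL-Probability.Probability_Measure" "HOL-Algebra.Bij" "HOL-Algebra.Generated_Groups"
begin

section \<open>Topological groupoids\<close>

text \<open>
  The set of arrows is \<open>topspace (arrows G)\<close>, the units are particular arrows, and
  \<open>gmult G g h\<close> is only meaningful for composable pairs, i.e. when \<open>src G g = rng G h\<close>.
\<close>

record 'g top_groupoid =
  arrows :: "'g topology"
  src :: "'g \<Rightarrow> 'g"
  rng :: "'g \<Rightarrow> 'g"
  gmult :: "'g \<Rightarrow> 'g \<Rightarrow> 'g"
  ginv :: "'g \<Rightarrow> 'g"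

definition composable :: "'g top_groupoid \<Rightarrow> ('g \<times> 'g) set" where
  "composable G =
    {(g, h). g \<in> topspace (arrows G) \<and> h \<in> topspace (arrows G) \<and> src G g = rng G h}"

definition units :: "'g top_groupoid \<Rightarrow> 'g set" where
  "units G = src G ` topspace (arrows G)"

definition unit_space :: "'g top_groupoid \<Rightarrow> 'g topology" where
  "unit_space G = subtopology (arrows G) (units G)"

locale topological_groupoid =
  fixes G :: "'g top_groupoid"
  assumes src_closed: "g \<in> topspace (arrows G) \<Longrightarrow> src G g \<in> topspace (arrows G)"
    and rng_in_units: "g \<in> topspace (arrows G) \<Longrightarrow> rng G g \<in> units G"
    and src_unit: "x \<in> units G \<Longrightarrow> src G x = x"
    and rng_unit: "x \<in> units G \<Longrightarrow> rng G x = x"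
    and gmult_closed: "(g, h) \<in> composable G \<Longrightarrow> gmult G g h \<in> topspace (arrows G)"
    and src_gmult: "(g, h) \<in> composable G \<Longrightarrow> src G (gmult G g h) = src G h"
    and rng_gmult: "(g, h) \<in> composable G \<Longrightarrow> rng G (gmult G g h) = rng G g"
    and gmult_assoc: "\<lbrakk>(g, h) \<in> composable G; (h, k) \<in> composable G\<rbrakk>
        \<Longrightarrow> gmult G (gmult G g h) k = gmult G g (gmult G h k)"
    and gmult_src: "g \<in> topspace (arrows G) \<Longrightarrow> gmult G g (src G g) = g"
    and gmult_rng: "g \<in> topspace (arrows G) \<Longrightarrow> gmult G (rng G g) g = g"
    and ginv_closed: "g \<in> topspace (arrows G) \<Longrightarrow> ginv G g \<in> topspace (arrows G)"
    and src_ginv: "g \<in> topspace (arrows G) \<Longrightarrow> src G (ginv G g) = rng G g"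
    and rng_ginv: "g \<in> topspace (arrows G) \<Longrightarrow> rng G (ginv G g) = src G g"
    and ginv_left: "g \<in> topspace (arrows G) \<Longrightarrow> gmult G (ginv G g) g = src G g"
    and ginv_right: "g \<in> topspace (arrows G) \<Longrightarrow> gmult G g (ginv G g) = rng G g"
    and continuous_gmult: "continuous_map
        (subtopology (prod_topology (arrows G) (arrows G)) (composable G)) (arrows G)
        (\<lambda>(g, h). gmult G g h)"
    and continuous_ginv: "continuous_map (arrows G) (arrows G) (ginv G)"

definition local_homeomorphism :: "'a topology \<Rightarrow> 'b topology \<Rightarrow> ('a \<Rightarrow> 'b) \<Rightarrow> bool" where
  "local_homeomorphism X Y f \<longleftrightarrow>
    (\<forall>x \<in> topspace X. \<exists>U. openin X U \<and> x \<in> U \<and> openin Y (f ` U) \<and>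
       homeomorphic_map (subtopology X U) (subtopology Y (f ` U)) f)"

locale etale_groupoid = topological_groupoid +
  assumes locally_compact: "locally_compact_space (arrows G)"
    and Hausdorff: "Hausdorff_space (arrows G)"
    and src_local_homeomorphism: "local_homeomorphism (arrows G) (unit_space G) (src G)"
    and rng_local_homeomorphism: "local_homeomorphism (arrows G) (unit_space G) (rng G)"

definition orbit :: "'g top_groupoid \<Rightarrow> 'g \<Rightarrow> 'g set" where
  "orbit G x = {rng G g | g. g \<in> topspace (arrows G) \<and> src G g = x}"

definition minimal_groupoid :: "'g top_groupoid \<Rightarrow> bool" where
  "minimal_groupoid G \<longleftrightarrow>
    (\<forall>x \<in> units G. Abstract_Topology.closure_of (unit_space G) (orbit G x) = units G)"

definition bisection :: "'g top_groupoid \<Rightarrow> 'g set \<Rightarrow> bool" where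
  "bisection G U \<longleftrightarrow> U \<subseteq> topspace (arrows G) \<and> inj_on (rng G) U \<and> inj_on (src G) U"


section \<open>Cantor spaces\<close>

text \<open>The middle-thirds set: the reals with a ternary expansion using the digits 0 and 2 only.\<close>

definition cantor_set :: "real set" where
  "cantor_set = range (\<lambda>b :: nat \<Rightarrow> bool. \<Sum>n. 2 * of_bool (b n) / 3 ^ Suc n)"

definition cantor_space :: "'a topology \<Rightarrow> bool" where
  "cantor_space X \<longleftrightarrow> X homeomorphic_space (top_of_set cantor_set)"


section \<open>Invariant measures and comparison\<close>

definition borel_sets :: "'a topology \<Rightarrow> 'a set set" where
  "borel_sets X = sigma_sets (topspace X) {U. openin X U}"

definition regular_borel_probability :: "'a topology \<Rightarrow> 'a measure \<Rightarrow> bool" where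
  "regular_borel_probability X \<mu> \<longleftrightarrow>
    prob_space \<mu> \<and> space \<mu> = topspace X \<and> sets \<mu> = borel_sets X \<and>
    (\<forall>E \<in> borel_sets X.
       emeasure \<mu> E = (INF U \<in> {U. openin X U \<and> E \<subseteq> U}. emeasure \<mu> U) \<and>
       emeasure \<mu> E = (SUP K \<in> {K. compactin X K \<and> K \<in> borel_sets X \<and> K \<subseteq> E}. emeasure \<mu> K))"

definition invariant_measures :: "'g top_groupoid \<Rightarrow> 'g measure set" where
  "invariant_measures G =
    {\<mu>. regular_borel_probability (unit_space G) \<mu> \<and>
        (\<forall>U E. openin (arrows G) U \<and> bisection G U \<and> E \<in> borel_sets (arrows G) \<and> E \<subseteq> U
           \<longrightarrow> emeasure \<mu> (src G ` E) = emeasure \<mu> (rng G ` E))}"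

definition clopenin :: "'a topology \<Rightarrow> 'a set \<Rightarrow> bool" where
  "clopenin X A \<longleftrightarrow> openin X A \<and> closedin X A"

definition has_comparison :: "'g top_groupoid \<Rightarrow> bool" where
  "has_comparison G \<longleftrightarrow>
    (\<forall>A B. clopenin (unit_space G) A \<and> clopenin (unit_space G) B \<and> B \<noteq> {} \<and>
       (\<forall>\<mu> \<in> invariant_measures G. emeasure \<mu> A < emeasure \<mu> B)
       \<longrightarrow> (\<exists>U. compactin (arrows G) U \<and> openin (arrows G) U \<and> bisection G U \<and>
                src G ` U = A \<and> rng G ` U \<subseteq> B))"


section \<open>The full group and simplicity\<close>

text \<open>
  As in \<^const>\<open>BijGroup\<close>, a self-map of the unit space is represented by the function that is
  \<^const>\<open>undefined\<close> off the units.
\<close>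

definition full_group :: "'g top_groupoid \<Rightarrow> ('g \<Rightarrow> 'g) monoid" where
  "full_group G = (BijGroup (units G))
    \<lparr>carrier := {\<alpha> \<in> Bij (units G).
       homeomorphic_map (unit_space G) (unit_space G) \<alpha> \<and>
       (\<forall>x \<in> units G. \<exists>g \<in> topspace (arrows G). src G g = x \<and> rng G g = \<alpha> x)}\<rparr>"

definition commutator_subgroup :: "('a, 'b) monoid_scheme \<Rightarrow> ('a, 'b) monoid_scheme" where
  "commutator_subgroup \<Gamma> = \<Gamma>\<lparr>carrier := derived \<Gamma> (carrier \<Gamma>)\<rparr>"

text \<open>
  The library's \<open>simple_group\<close> requires \<open>order G > 1\<close> and hence excludes all infinite
  groups, whose \<^const>\<open>order\<close> is 0.
\<close>

definition is_simple :: "('a, 'b) monoid_scheme \<Rightarrow> bool" where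
  "is_simple \<Gamma> \<longleftrightarrow> group \<Gamma> \<and> carrier \<Gamma> \<noteq> {\<one>\<^bsub>\<Gamma>\<^esub>} \<and>
    (\<forall>N. N \<lhd> \<Gamma> \<longrightarrow> N = {\<one>\<^bsub>\<Gamma>\<^esub>} \<or> N = carrier \<Gamma>)"

end

theory Submission
  imports Defs
begin

text \<open>
  Why the theorem holds.  Let \<open>\<Gamma>\<close> be the full group and \<open>N\<close> a nontrivial normal subgroup of its
  commutator subgroup \<open>\<Gamma>'\<close>; the aim is \<open>\<Gamma>' \<subseteq> N\<close>.

  Some \<open>\<alpha> \<in> N\<close> moves a nonempty clopen set \<open>U\<close> off itself.  If \<open>f, g \<in> \<Gamma>'\<close> live on \<open>U\<close>, then
  \<open>\<alpha> f\<^sup>-\<^sup>1 \<alpha>\<^sup>-\<^sup>1\<close> commutes with \<open>g\<close>, so \<open>[f, g] = [[f, \<alpha>], g] \<in> N\<close>.  If \<open>a, b \<in> \<Gamma>\<close> live on a set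
  \<open>V \<subseteq> U\<close> with two further disjoint copies \<open>k V, l V\<close> inside \<open>U\<close>, then \<open>[a, b] = [[a, k], [b, l]]\<close>,
  so the same holds without assuming that \<open>a, b\<close> are in \<open>\<Gamma>'\<close>.  By comparison, every clopen \<open>Z\<close> that is not the
  whole space and has small mass under all invariant measures can be moved into \<open>U\<close> by an element of
  \<open>\<Gamma>'\<close>; hence \<open>[a, b] \<in> N\<close> whenever \<open>a, b\<close> live on such a \<open>Z\<close> (\<open>small_commutators\<close>).

  It remains to break arbitrary elements into small ones (\<open>generate_fragments\<close>): near a point, an
  element \<open>f\<close> agrees with the product of two swaps, one of a small set \<open>V\<close> with a disjoint set
  \<open>\<theta> V\<close> provided by comparison, the other of \<open>\<theta> V\<close> with \<open>f V\<close>.  Swaps can be cut into swaps of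
  arbitrarily small pieces.  Dividing them off one after the other leaves an element that lives on
  a small set.  As the commutator is bilinear up to conjugation, \<open>\<Gamma>'\<close> is generated by the
  conjugates of the commutators of fragments; smallness is invariant under \<open>\<Gamma>\<close>, so all of these are
  in \<open>N\<close> (\<open>derived_subset_of_generators\<close>).

  This argument uses only a Boolean algebra of clopen sets, gluing, invariant masses and
  comparison, and is carried out in the locale \<open>comparison_group\<close>.  That the full group is an
  instance rests on two facts.  Minimality bounds masses: if \<open>U\<close> is clopen and nonempty, each point
  has a neighbourhood that a bisection embeds into \<open>U\<close>, which gives both a positive lower bound for
  the mass of \<open>U\<close> and neighbourhoods of arbitrarily small mass.  Second countability makes each
  element of the full group a countable union of Borel pieces of bisections, although it need not be
  given by a bisection near any point; so it preserves the invariant measures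
  (\<open>full_group_preserves_measure\<close>).

  No invariant measure need exist.  Then any two nonempty disjoint clopen sets compare, and the only
  requirement on \<open>Z\<close> is \<open>Z \<noteq> X\<close>.  This is why the smallness of \<open>Z\<close> includes that condition.
\<close>

section \<open>Commutators\<close>

definition commutator :: "('a, 'b) monoid_scheme \<Rightarrow> 'a \<Rightarrow> 'a \<Rightarrow> 'a" where
  "commutator K a b = a \<otimes>\<^bsub>K\<^esub> b \<otimes>\<^bsub>K\<^esub> inv\<^bsub>K\<^esub> a \<otimes>\<^bsub>K\<^esub> inv\<^bsub>K\<^esub> b"

context group
begin

lemma commutator_closed [simp]: "a \<in> carrier G \<Longrightarrow> b \<in> carrier G \<Longrightarrow> commutator G a b \<in> carrier G"
  by (simp add: commutator_def)

lemma commutator_in_derived: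
  "a \<in> carrier G \<Longrightarrow> b \<in> carrier G \<Longrightarrow> commutator G a b \<in> derived G (carrier G)"
  unfolding derived_def commutator_def by (rule generate.incl) blast

lemma inv_commutator:
  "a \<in> carrier G \<Longrightarrow> b \<in> carrier G \<Longrightarrow> inv (commutator G a b) = commutator G b a"
  by (simp add: commutator_def inv_mult_group m_assoc)

lemma cancel_left_inv [simp]: "a \<in> carrier G \<Longrightarrow> b \<in> carrier G \<Longrightarrow> inv a \<otimes> (a \<otimes> b) = b"
  by (simp flip: m_assoc)

lemma cancel_left [simp]: "a \<in> carrier G \<Longrightarrow> b \<in> carrier G \<Longrightarrow> a \<otimes> (inv a \<otimes> b) = b"
  by (simp flip: m_assoc)

lemma conj_commutator:
  assumes "a \<in> carrier G" "b \<in> carrier G" "c \<in> carrier G"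
  shows "c \<otimes> commutator G a b \<otimes> inv c = commutator G (c \<otimes> a \<otimes> inv c) (c \<otimes> b \<otimes> inv c)"
  using assms by (simp add: commutator_def inv_mult_group m_assoc)

lemma commutator_mult_left:
  assumes "a \<in> carrier G" "b \<in> carrier G" "c \<in> carrier G"
  shows "commutator G (a \<otimes> b) c = (a \<otimes> commutator G b c \<otimes> inv a) \<otimes> commutator G a c"
  using assms by (simp add: commutator_def inv_mult_group m_assoc)

lemma commutator_inv_left:
  assumes "a \<in> carrier G" "c \<in> carrier G"
  shows "commutator G (inv a) c = inv a \<otimes> inv (commutator G a c) \<otimes> inv (inv a)"
  using assms by (simp add: commutator_def inv_mult_group m_assoc)

text \<open>Multiplying an argument by something that commutes with the other argument changes nothing.\<close>

lemma commutator_absorb_left: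
  assumes "x \<in> carrier G" "y \<in> carrier G" "z \<in> carrier G" "y \<otimes> z = z \<otimes> y"
  shows "commutator G (x \<otimes> y) z = commutator G x z"
proof -
  have "commutator G (x \<otimes> y) z = x \<otimes> (y \<otimes> z) \<otimes> inv y \<otimes> inv x \<otimes> inv z"
    using assms(1-3) by (simp add: commutator_def inv_mult_group m_assoc)
  also have "\<dots> = commutator G x z"
    unfolding assms(4) using assms(1-3) by (simp add: commutator_def m_assoc)
  finally show ?thesis .
qed

lemma commutator_absorb_right:
  assumes "x \<in> carrier G" "y \<in> carrier G" "z \<in> carrier G" "y \<otimes> z = z \<otimes> y"
  shows "commutator G z (x \<otimes> y) = commutator G z x"
  using commutator_absorb_left[OF assms] assms(1-3) inv_commutator m_closed by metis

text \<open>
  The commutator is bilinear up to conjugation.  So a subgroup that contains all conjugates of the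
  commutators of generators contains every commutator: the elements all of whose conjugates lie in
  \<open>N\<close> form a subgroup that is normal in the whole group.
\<close>

lemma derived_subset_of_generators:
  assumes N: "subgroup N G" and T: "T \<subseteq> carrier G" and gen: "generate G T = carrier G"
    and conj: "\<And>a b c. a \<in> T \<Longrightarrow> b \<in> T \<Longrightarrow> c \<in> carrier G \<Longrightarrow> c \<otimes> commutator G a b \<otimes> inv c \<in> N"
  shows "derived G (carrier G) \<subseteq> N"
proof -
  define core where "core = {x \<in> carrier G. \<forall>c \<in> carrier G. c \<otimes> x \<otimes> inv c \<in> N}"
  have core_carrier: "x \<in> core \<Longrightarrow> x \<in> carrier G" for x
    by (simp add: core_def)
  have core_mult: "x \<otimes> y \<in> core" if "x \<in> core" "y \<in> core" for x y
  proof -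
    have "c \<otimes> (x \<otimes> y) \<otimes> inv c = (c \<otimes> x \<otimes> inv c) \<otimes> (c \<otimes> y \<otimes> inv c)" if "c \<in> carrier G" for c
      using that \<open>x \<in> core\<close> \<open>y \<in> core\<close> by (simp add: core_def m_assoc)
    then show ?thesis
      using that subgroup.m_closed[OF N] by (simp add: core_def)
  qed
  have core_inv: "inv x \<in> core" if "x \<in> core" for x
  proof -
    have "c \<otimes> inv x \<otimes> inv c = inv (c \<otimes> x \<otimes> inv c)" if "c \<in> carrier G" for c
      using that \<open>x \<in> core\<close> by (simp add: core_def inv_mult_group m_assoc)
    then show ?thesis
      using that subgroup.m_inv_closed[OF N] by (simp add: core_def)
  qed
  have core_conj: "d \<otimes> x \<otimes> inv d \<in> core" if "x \<in> core" and d: "d \<in> carrier G" for x d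
  proof -
    have "c \<otimes> (d \<otimes> x \<otimes> inv d) \<otimes> inv c = (c \<otimes> d) \<otimes> x \<otimes> inv (c \<otimes> d)" if "c \<in> carrier G" for c
      using that d core_carrier[OF \<open>x \<in> core\<close>] by (simp add: inv_mult_group m_assoc)
    then show ?thesis
      using \<open>x \<in> core\<close> d by (simp add: core_def)
  qed
  have left: "commutator G a b \<in> core"
    if a: "a \<in> generate G T" and b: "b \<in> carrier G"
      and T': "\<And>t. t \<in> T \<Longrightarrow> commutator G t b \<in> core" for a b
    using a
  proof (induction rule: generate.induct)
    case one
    then show ?case using b subgroup.one_closed[OF N]
      by (simp add: core_def commutator_def)
  next
    case (incl h) then show ?case by (rule T')
  next
    case (inv h)
    then have "h \<in> carrier G" using T by blast
    then show ?case
      using core_conj[OF core_inv[OF T'[OF inv]], of "inv h"] b by (simp add: commutator_inv_left)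
  next
    case (eng h1 h2)
    then have "h1 \<in> carrier G" "h2 \<in> carrier G" using gen by auto
    then show ?case
      using core_mult[OF core_conj[OF eng.IH(2)] eng.IH(1)] b by (simp add: commutator_mult_left)
  qed
  have TT: "commutator G t u \<in> core" if "t \<in> T" "u \<in> T" for t u
    using that conj commutator_closed[OF subsetD[OF T] subsetD[OF T]] by (auto simp: core_def)
  have "commutator G u a \<in> core" if "u \<in> T" "a \<in> carrier G" for a u
    using core_inv[OF left[of a u]] that TT T gen inv_commutator by auto
  then have all: "commutator G a b \<in> core" if "a \<in> carrier G" "b \<in> carrier G" for a b
    using left[of a b] that gen by auto
  have "commutator G a b \<in> N" if "a \<in> carrier G" "b \<in> carrier G" for a b
    using all[OF that] that by (auto simp: core_def dest!: bspec[of _ _ "\<one>"])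
  then have "derived_set G (carrier G) \<subseteq> N"
    by (auto simp: commutator_def)
  then show ?thesis
    unfolding derived_def by (rule generate_subgroup_incl[OF _ N])
qed

end


section \<open>Groups of permutations\<close>

text \<open>
  Elements act as bijections of \<open>X\<close>, represented by functions that are \<^const>\<open>undefined\<close> off
  \<open>X\<close>, so that two elements are equal as soon as they agree on \<open>X\<close>.
\<close>

locale permutation_group = group K for K :: "('a \<Rightarrow> 'a, 'b) monoid_scheme" (structure) +
  fixes X :: "'a set"
  assumes carrier_Bij: "carrier K \<subseteq> Bij X"
    and apply_mult: "f \<in> carrier K \<Longrightarrow> g \<in> carrier K \<Longrightarrow> x \<in> X \<Longrightarrow> (f \<otimes> g) x = f (g x)"
begin

lemma apply_in [intro]: "f \<in> carrier K \<Longrightarrow> x \<in> X \<Longrightarrow> f x \<in> X"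
  using carrier_Bij by (auto simp: Bij_def bij_betw_def)

lemma apply_inj: "f \<in> carrier K \<Longrightarrow> x \<in> X \<Longrightarrow> y \<in> X \<Longrightarrow> f x = f y \<longleftrightarrow> x = y"
  using carrier_Bij by (auto simp: Bij_def bij_betw_def inj_on_def)

lemma image_carrier: "f \<in> carrier K \<Longrightarrow> f ` X = X"
  using carrier_Bij by (auto simp: Bij_def bij_betw_def)

lemma apply_one [simp]: "x \<in> X \<Longrightarrow> \<one> x = x"
  using apply_mult[of \<one> \<one> x] apply_inj[of \<one> "\<one> x" x] by auto

lemma apply_inv_left [simp]: "f \<in> carrier K \<Longrightarrow> x \<in> X \<Longrightarrow> (inv f) (f x) = x"
  using apply_mult[of "inv f" f x] by simp

lemma apply_inv_right [simp]: "f \<in> carrier K \<Longrightarrow> x \<in> X \<Longrightarrow> f ((inv f) x) = x"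
  using apply_mult[of f "inv f" x] by simp

lemma perm_eqI:
  assumes "f \<in> carrier K" "g \<in> carrier K" "\<And>x. x \<in> X \<Longrightarrow> f x = g x"
  shows "f = g"
  using assms carrier_Bij by (intro extensionalityI[of _ X]) (auto simp: Bij_def)

lemma image_subset: "f \<in> carrier K \<Longrightarrow> A \<subseteq> X \<Longrightarrow> f ` A \<subseteq> X"
  by auto

lemma mem_image_iff: "f \<in> carrier K \<Longrightarrow> A \<subseteq> X \<Longrightarrow> x \<in> X \<Longrightarrow> x \<in> f ` A \<longleftrightarrow> (inv f) x \<in> A"
proof -
  assume f: "f \<in> carrier K" and A: "A \<subseteq> X" and x: "x \<in> X"
  show ?thesis
  proof
    assume "x \<in> f ` A"
    then obtain a where "a \<in> A" "x = f a" by blast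
    then show "(inv f) x \<in> A" using f A by auto
  next
    assume "(inv f) x \<in> A"
    then have "f ((inv f) x) \<in> f ` A" by (rule imageI)
    then show "x \<in> f ` A" using f x by simp
  qed
qed

lemma image_mult: "f \<in> carrier K \<Longrightarrow> g \<in> carrier K \<Longrightarrow> A \<subseteq> X \<Longrightarrow> (f \<otimes> g) ` A = f ` (g ` A)"
  by (auto simp: apply_mult image_image subset_iff cong: image_cong)

definition supported :: "'a set \<Rightarrow> ('a \<Rightarrow> 'a) set" where
  "supported A = {f \<in> carrier K. \<forall>x \<in> X - A. f x = x}"

lemma supported_carrier: "f \<in> supported A \<Longrightarrow> f \<in> carrier K"
  by (simp add: supported_def)

lemma supported_fix: "f \<in> supported A \<Longrightarrow> x \<in> X \<Longrightarrow> x \<notin> A \<Longrightarrow> f x = x"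
  by (simp add: supported_def)

lemma supported_mono: "f \<in> supported A \<Longrightarrow> A \<subseteq> B \<Longrightarrow> f \<in> supported B"
  by (auto simp: supported_def)

lemma supported_mult: "f \<in> supported A \<Longrightarrow> g \<in> supported A \<Longrightarrow> f \<otimes> g \<in> supported A"
  by (auto simp: supported_def apply_mult)

lemma supported_inv: "f \<in> supported A \<Longrightarrow> inv f \<in> supported A"
proof -
  assume f: "f \<in> supported A"
  have "(inv f) x = x" if "x \<in> X - A" for x
    using apply_inv_left[OF supported_carrier[OF f], of x] that f by (simp add: supported_def)
  then show ?thesis using f by (simp add: supported_def)
qed

text \<open>A point of \<open>A\<close> cannot be sent to a fixed point outside \<open>A\<close>, by injectivity.\<close>

lemma supported_stable:
  assumes "f \<in> supported A" "x \<in> X" "x \<in> A"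
  shows "f x \<in> A"
proof (rule ccontr)
  assume "f x \<notin> A"
  moreover have K: "f \<in> carrier K" using assms(1) by (rule supported_carrier)
  ultimately have "f (f x) = f x"
    using assms apply_in[OF K, of x] by (auto simp: supported_def)
  then have "f x = x"
    using apply_inj[OF K apply_in[OF K assms(2)] assms(2)] by simp
  then show False using \<open>f x \<notin> A\<close> assms(3) by simp
qed

lemma supported_conj:
  assumes f: "f \<in> supported A" and c: "c \<in> carrier K" and "A \<subseteq> X"
  shows "c \<otimes> f \<otimes> inv c \<in> supported (c ` A)"
proof -
  have "(c \<otimes> f \<otimes> inv c) x = x" if "x \<in> X" "x \<notin> c ` A" for x
  proof -
    have "(inv c) x \<notin> A"
      using that c \<open>A \<subseteq> X\<close> by (simp add: mem_image_iff)
    then have "f ((inv c) x) = (inv c) x"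
      using f c that by (auto simp: supported_def)
    then show ?thesis
      using f c that supported_carrier by (simp add: apply_mult apply_in)
  qed
  then show ?thesis
    using c supported_carrier[OF f] by (simp add: supported_def)
qed

lemma supported_commute:
  assumes f: "f \<in> supported A" and g: "g \<in> supported B" and "A \<inter> B = {}"
  shows "f \<otimes> g = g \<otimes> f"
proof (rule perm_eqI)
  note K = supported_carrier[OF f] supported_carrier[OF g]
  show "f \<otimes> g \<in> carrier K" "g \<otimes> f \<in> carrier K" using K by auto
  fix x assume x: "x \<in> X"
  consider "x \<in> A" | "x \<in> B" | "x \<notin> A" "x \<notin> B" by blast
  then have "f (g x) = g (f x)"
  proof cases
    case 1
    then have "x \<notin> B" "f x \<notin> B"
      using assms(3) supported_stable[OF f x] by auto
    then show ?thesis
      using supported_fix[OF g x] supported_fix[OF g apply_in[OF K(1) x]] by simp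
  next
    case 2
    then have "x \<notin> A" "g x \<notin> A"
      using assms(3) supported_stable[OF g x] by auto
    then show ?thesis
      using supported_fix[OF f x] supported_fix[OF f apply_in[OF K(2) x]] by simp
  next
    case 3
    then show ?thesis using x supported_fix[OF f] supported_fix[OF g] by simp
  qed
  then show "(f \<otimes> g) x = (g \<otimes> f) x" using K x by (simp add: apply_mult)
qed

end


section \<open>Permutation groups acting on a Boolean algebra with comparison\<close>

text \<open>
  \<open>C\<close> stands for the clopen subsets of the Cantor space \<open>X\<close>, \<open>M\<close> for the invariant measures restricted
  to them.  The assumption \<open>glue\<close> is the closure property that full groups have: a bijection that is
  locally in the group is in the group.  The assumption \<open>subordinate\<close> is the trace that minimality leaves on the measures.
\<close>

locale comparison_group = permutation_group K X
  for K :: "('a \<Rightarrow> 'a, 'b) monoid_scheme" (structure) and X :: "'a set" +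
  fixes C :: "'a set set" and M :: "('a set \<Rightarrow> real) set"
  assumes C_algebra: "algebra X C"
    and nonempty: "X \<noteq> {}"
    and separated: "x \<in> X \<Longrightarrow> y \<in> X \<Longrightarrow> x \<noteq> y \<Longrightarrow> \<exists>A \<in> C. x \<in> A \<and> y \<notin> A"
    and finite_subcover: "\<U> \<subseteq> C \<Longrightarrow> X \<subseteq> \<Union> \<U> \<Longrightarrow> \<exists>\<F>. finite \<F> \<and> \<F> \<subseteq> \<U> \<and> X \<subseteq> \<Union> \<F>"
    and perfect: "A \<in> C \<Longrightarrow> x \<in> A \<Longrightarrow> \<exists>y \<in> A. y \<noteq> x"
    and image_clopen: "f \<in> carrier K \<Longrightarrow> A \<in> C \<Longrightarrow> f ` A \<in> C"
    and glue: "f \<in> Bij X \<Longrightarrow> (\<And>x. x \<in> X \<Longrightarrow> \<exists>A \<in> C. x \<in> A \<and> (\<exists>g \<in> carrier K. \<forall>y \<in> A. f y = g y))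
        \<Longrightarrow> f \<in> carrier K"
    and mass_nonneg: "m \<in> M \<Longrightarrow> A \<in> C \<Longrightarrow> 0 \<le> m A"
    and mass_total: "m \<in> M \<Longrightarrow> m X = 1"
    and mass_add: "m \<in> M \<Longrightarrow> A \<in> C \<Longrightarrow> B \<in> C \<Longrightarrow> A \<inter> B = {} \<Longrightarrow> m (A \<union> B) = m A + m B"
    and mass_image: "m \<in> M \<Longrightarrow> f \<in> carrier K \<Longrightarrow> A \<in> C \<Longrightarrow> m (f ` A) = m A"
    and comparison: "A \<in> C \<Longrightarrow> B \<in> C \<Longrightarrow> A \<inter> B = {} \<Longrightarrow> B \<noteq> {} \<Longrightarrow> (\<And>m. m \<in> M \<Longrightarrow> m A < m B)
        \<Longrightarrow> \<exists>g \<in> carrier K. g ` A \<subseteq> B"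
    and subordinate: "x \<in> X \<Longrightarrow> U \<in> C \<Longrightarrow> U \<noteq> {} \<Longrightarrow> \<exists>V \<in> C. x \<in> V \<and> (\<forall>m \<in> M. m V \<le> m U)"
begin

subsection \<open>Clopen sets\<close>

interpretation C: algebra X C by (rule C_algebra)

lemma clopen_ops [simp, intro]:
  "{} \<in> C" "X \<in> C"
  "A \<in> C \<Longrightarrow> B \<in> C \<Longrightarrow> A \<union> B \<in> C"
  "A \<in> C \<Longrightarrow> B \<in> C \<Longrightarrow> A \<inter> B \<in> C"
  "A \<in> C \<Longrightarrow> B \<in> C \<Longrightarrow> A - B \<in> C"
  by auto

lemma clopen_subset: "A \<in> C \<Longrightarrow> A \<subseteq> X"
  by (rule C.sets_into_space)

lemma mass_mono:
  assumes "m \<in> M" "A \<in> C" "B \<in> C" "A \<subseteq> B"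
  shows "m A \<le> m B"
  using mass_add[of m A "B - A"] mass_nonneg[of m "B - A"] assms by (simp add: Un_absorb1)

lemma mass_empty [simp]: "m \<in> M \<Longrightarrow> m {} = 0"
  using mass_add[of m "{}" "{}"] by simp

lemma mass_Diff_ge:
  assumes "m \<in> M" "A \<in> C" "B \<in> C"
  shows "m A - m B \<le> m (A - B)"
  using mass_add[of m "A - B" "A \<inter> B"] mass_mono[of m "A \<inter> B" B] assms
  by (simp add: Un_Diff_Int Diff_Int_distrib2)

lemma mass_Un_le:
  assumes "m \<in> M" "A \<in> C" "B \<in> C"
  shows "m (A \<union> B) \<le> m A + m B"
  using mass_add[of m A "B - A"] mass_mono[of m "B - A" B] assms by simp

text \<open>
  Compactness as an induction principle: the whole space is exhausted by finitely many disjoint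
  pieces that satisfy any given local and hereditary property.
\<close>

lemma clopen_induct:
  assumes loc: "\<And>x. x \<in> X \<Longrightarrow> \<exists>V \<in> C. x \<in> V \<and> Q V"
    and hereditary: "\<And>V W. V \<in> C \<Longrightarrow> W \<in> C \<Longrightarrow> Q V \<Longrightarrow> W \<subseteq> V \<Longrightarrow> Q W"
    and empty: "P {}"
    and step: "\<And>W V. W \<in> C \<Longrightarrow> V \<in> C \<Longrightarrow> W \<inter> V = {} \<Longrightarrow> Q V \<Longrightarrow> P W \<Longrightarrow> P (W \<union> V)"
  shows "P X"
proof -
  define \<U> where "\<U> = {V \<in> C. Q V}"
  have "X \<subseteq> \<Union> \<U>"
  proof
    fix x assume "x \<in> X"
    then obtain V where "V \<in> C" "x \<in> V" "Q V" using loc by blast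
    then show "x \<in> \<Union> \<U>" by (auto simp: \<U>_def)
  qed
  then obtain \<F> where \<F>: "finite \<F>" "\<F> \<subseteq> \<U>" "X \<subseteq> \<Union> \<F>"
    using finite_subcover[of \<U>] by (auto simp: \<U>_def)
  have "\<Union> \<F> \<in> C \<and> P (\<Union> \<F>)"
    using \<F>(1,2)
  proof (induction \<F> rule: finite_induct)
    case empty then show ?case using assms(3) by simp
  next
    case (insert V \<F>)
    then have V: "V \<in> C" "Q V" and W: "\<Union> \<F> \<in> C" "P (\<Union> \<F>)" by (auto simp: \<U>_def)
    have "P (\<Union> \<F> \<union> (V - \<Union> \<F>))"
      using V W hereditary[of V "V - \<Union> \<F>"] by (intro step) auto
    then show ?case using V W by (simp add: Un_commute)
  qed
  moreover have "\<Union> \<F> = X"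
    using \<F>(2,3) clopen_subset by (auto simp: \<U>_def)
  ultimately show ?thesis by simp
qed

lemma avoid_finite:
  assumes "x \<in> X" "finite F" "F \<subseteq> X"
  shows "\<exists>A \<in> C. x \<in> A \<and> A \<inter> F \<subseteq> {x}"
  using assms(2,3)
proof (induction F rule: finite_induct)
  case empty then show ?case using assms(1) by auto
next
  case (insert y F)
  then obtain A where A: "A \<in> C" "x \<in> A" "A \<inter> F \<subseteq> {x}" by auto
  show ?case
  proof (cases "y = x")
    case True then show ?thesis using A by auto
  next
    case False
    then obtain B where "B \<in> C" "x \<in> B" "y \<notin> B"
      using separated[of x y] assms(1) insert.prems by auto
    then show ?thesis using A by (intro bexI[of _ "A \<inter> B"]) auto
  qed
qed

lemma split_clopen:
  assumes "U \<in> C" "U \<noteq> {}"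
  obtains P Q where "P \<in> C" "Q \<in> C" "P \<noteq> {}" "Q \<noteq> {}" "P \<inter> Q = {}" "P \<subseteq> U" "Q \<subseteq> U" "P \<union> Q = U"
proof -
  obtain x where x: "x \<in> U" using assms by auto
  then obtain y where y: "y \<in> U" "y \<noteq> x" using perfect assms by blast
  then obtain A where A: "A \<in> C" "x \<in> A" "y \<notin> A"
    using separated[of x y] x clopen_subset[OF assms(1)] by auto
  show thesis
    by (rule that[of "U \<inter> A" "U - A"]) (use A x y assms in auto)
qed

text \<open>Finitely many sets subordinate to \<open>U\<close> cover \<open>X\<close>, which has mass 1; their number bounds \<open>1 / m U\<close>.\<close>

lemma mass_lower_bound:
  assumes "U \<in> C" "U \<noteq> {}"
  obtains \<delta> where "\<delta> > 0" "\<And>m. m \<in> M \<Longrightarrow> \<delta> \<le> m U"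
proof -
  have "\<exists>n::nat. \<forall>m \<in> M. m X \<le> real n * m U"
  proof (rule clopen_induct[where Q = "\<lambda>V. \<forall>m \<in> M. m V \<le> m U"])
    show "\<exists>V \<in> C. x \<in> V \<and> (\<forall>m \<in> M. m V \<le> m U)" if "x \<in> X" for x
      using subordinate that assms by blast
    show "\<forall>m \<in> M. m W \<le> m U" if "V \<in> C" "W \<in> C" "\<forall>m \<in> M. m V \<le> m U" "W \<subseteq> V" for V W
      using that mass_mono by (meson order_trans)
    show "\<exists>n::nat. \<forall>m \<in> M. m {} \<le> real n * m U"
      by (intro exI[of _ 0]) simp
    fix W V assume *: "W \<in> C" "V \<in> C" "W \<inter> V = {}" "\<forall>m \<in> M. m V \<le> m U"
    assume "\<exists>n::nat. \<forall>m \<in> M. m W \<le> real n * m U"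
    then obtain n where "\<forall>m \<in> M. m W \<le> real n * m U" by blast
    with * have "\<forall>m \<in> M. m (W \<union> V) \<le> real (Suc n) * m U"
      by (auto simp: mass_add algebra_simps intro: add_mono)
    then show "\<exists>n::nat. \<forall>m \<in> M. m (W \<union> V) \<le> real n * m U" by blast
  qed
  then obtain n :: nat where n: "\<And>m. m \<in> M \<Longrightarrow> 1 \<le> real n * m U"
    using mass_total by force
  have "1 / real (Suc n) \<le> m U" if "m \<in> M" for m
  proof -
    have "1 \<le> real (Suc n) * m U" using n[OF that] mass_nonneg[OF that assms(1)] by (simp add: algebra_simps)
    then show ?thesis by (simp add: field_simps)
  qed
  then show thesis using that[of "1 / real (Suc n)"] by simp
qed

text \<open>
  Masses can be halved: split a nonempty \<open>U\<close> into \<open>P\<close> and \<open>Q\<close>, and take a piece of \<open>P\<close> whose mass is at most that of \<open>Q\<close>: it has at most half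
  the mass of \<open>U\<close>, for all masses at once.  Iterate.
\<close>

lemma small_clopen:
  fixes \<epsilon> :: real
  assumes "\<epsilon> > 0"
  obtains U where "U \<in> C" "U \<noteq> {}" "\<And>m. m \<in> M \<Longrightarrow> m U < \<epsilon>"
proof -
  have "\<exists>U \<in> C. U \<noteq> {} \<and> (\<forall>m \<in> M. 2 ^ n * m U \<le> 1)" for n :: nat
  proof (induction n)
    case 0
    have "2 ^ 0 * m X \<le> 1" if "m \<in> M" for m using mass_total[OF that] by simp
    then show ?case using nonempty by (intro bexI[of _ X]) auto
  next
    case (Suc n)
    then obtain U where U: "U \<in> C" "U \<noteq> {}" "\<forall>m \<in> M. 2 ^ n * m U \<le> 1" by blast
    obtain P Q where PQ: "P \<in> C" "Q \<in> C" "P \<noteq> {}" "Q \<noteq> {}" "P \<inter> Q = {}" "P \<union> Q = U"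
      using split_clopen[OF U(1,2)] by metis
    obtain x where x: "x \<in> P" using PQ by auto
    then obtain V where V: "V \<in> C" "x \<in> V" "\<forall>m \<in> M. m V \<le> m Q"
      using subordinate[of x Q] PQ clopen_subset by blast
    have "2 ^ Suc n * m (V \<inter> P) \<le> 1" if m: "m \<in> M" for m
    proof -
      have "m (V \<inter> P) \<le> m Q" "m (V \<inter> P) \<le> m P"
        using mass_mono[OF m, of "V \<inter> P" V] mass_mono[OF m, of "V \<inter> P" P] V PQ m by fastforce+
      then have "2 * m (V \<inter> P) \<le> m U"
        using mass_add[OF m PQ(1,2,5)] PQ(6) by simp
      then have "2 ^ n * (2 * m (V \<inter> P)) \<le> 2 ^ n * m U" by simp
      also have "\<dots> \<le> 1" using U(3) m by simp
      finally show ?thesis by (simp add: mult.assoc mult.left_commute)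
    qed
    then show ?case using V x PQ by (intro bexI[of _ "V \<inter> P"]) auto
  qed
  note halve = this
  obtain n :: nat where n: "1 / \<epsilon> < 2 ^ n" using real_arch_pow[of 2 "1 / \<epsilon>"] by auto
  obtain U where U: "U \<in> C" "U \<noteq> {}" "\<forall>m \<in> M. 2 ^ n * m U \<le> 1" using halve by blast
  have "m U < \<epsilon>" if m: "m \<in> M" for m
  proof (rule ccontr)
    assume "\<not> m U < \<epsilon>"
    then have "2 ^ n * \<epsilon> \<le> 2 ^ n * m U" by simp
    also have "\<dots> \<le> 1" using U m by simp
    finally show False using n assms by (simp add: field_simps)
  qed
  then show thesis using that U by blast
qed

lemma small_neighbourhood:
  fixes \<epsilon> :: real
  assumes "x \<in> A" "A \<in> C" "\<epsilon> > 0" "finite F" "F \<subseteq> X"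
  obtains V where "V \<in> C" "x \<in> V" "V \<subseteq> A" "V \<inter> F \<subseteq> {x}" "\<And>m. m \<in> M \<Longrightarrow> m V < \<epsilon>"
proof -
  have x: "x \<in> X" using assms(1,2) clopen_subset by blast
  obtain U where U: "U \<in> C" "U \<noteq> {}" "\<And>m. m \<in> M \<Longrightarrow> m U < \<epsilon>"
    using small_clopen[OF assms(3)] by blast
  obtain V where V: "V \<in> C" "x \<in> V" "\<forall>m \<in> M. m V \<le> m U"
    using subordinate[OF x U(1,2)] by blast
  obtain B where B: "B \<in> C" "x \<in> B" "B \<inter> F \<subseteq> {x}" using avoid_finite[OF x assms(4,5)] by blast
  have "m (V \<inter> B \<inter> A) < \<epsilon>" if "m \<in> M" for m
  proof -
    have "m (V \<inter> B \<inter> A) \<le> m V" using V(1) B(1) assms(2) that by (intro mass_mono) auto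
    also have "\<dots> < \<epsilon>" using V(3) U(3) that by fastforce
    finally show ?thesis .
  qed
  then show thesis
    using V B assms by (intro that[of "V \<inter> B \<inter> A"]) auto
qed

lemma infinite_X: "infinite X"
proof
  assume "finite X"
  obtain x where x: "x \<in> X" using nonempty by blast
  obtain A where "A \<in> C" "x \<in> A" "A \<inter> X \<subseteq> {x}" using avoid_finite[OF x \<open>finite X\<close>] by auto
  then show False using perfect[of A x] clopen_subset by blast
qed


subsection \<open>Swaps and restrictions\<close>

text \<open>An element that moves \<open>A\<close> off itself can be replaced by an involution with the same effect on \<open>A\<close>.\<close>

lemma swap_on:
  assumes g: "g \<in> carrier K" and A: "A \<in> C" and disj: "A \<inter> g ` A = {}"
  obtains \<sigma> where "\<sigma> \<in> supported (A \<union> g ` A)" "\<And>x. x \<in> A \<Longrightarrow> \<sigma> x = g x"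
    "\<And>x. x \<in> X \<Longrightarrow> \<sigma> (\<sigma> x) = x"
proof -
  define \<sigma> where "\<sigma> = (\<lambda>x \<in> X. if x \<in> A then g x else if x \<in> g ` A then (inv g) x else x)"
  have AX: "A \<subseteq> X" "g ` A \<subseteq> X" "g ` A \<in> C"
    using A g image_clopen clopen_subset by blast+
  have on_A: "\<sigma> x = g x" if "x \<in> A" for x using that AX by (auto simp: \<sigma>_def)
  have on_gA: "\<sigma> x = (inv g) x" "(inv g) x \<in> A" if "x \<in> g ` A" for x
    using that AX disj mem_image_iff[OF g AX(1), of x] by (auto simp: \<sigma>_def)
  have off: "\<sigma> x = x" if "x \<in> X" "x \<notin> A" "x \<notin> g ` A" for x using that by (simp add: \<sigma>_def)
  have invol: "\<sigma> (\<sigma> x) = x" if "x \<in> X" for x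
  proof -
    consider "x \<in> A" | "x \<in> g ` A" | "x \<notin> A" "x \<notin> g ` A" by blast
    then show ?thesis
    proof cases
      case 1
      then show ?thesis using on_A[OF 1] on_gA[of "g x"] g that by simp
    next
      case 2
      then show ?thesis using on_gA[OF 2] on_A g that by simp
    next
      case 3
      then show ?thesis using off that by simp
    qed
  qed
  have into: "\<sigma> x \<in> X" if "x \<in> X" for x
    using that on_A on_gA off AX by (cases "x \<in> A"; cases "x \<in> g ` A") auto
  have "bij_betw \<sigma> X X"
    by (rule bij_betw_byWitness[where f' = \<sigma>]) (use invol into in auto)
  then have "\<sigma> \<in> Bij X" by (simp add: Bij_def \<sigma>_def)
  then have "\<sigma> \<in> carrier K"
  proof (rule glue)
    fix x assume x: "x \<in> X"
    consider "x \<in> A" | "x \<in> g ` A" | "x \<in> X - A - g ` A" using x by blast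
    then show "\<exists>A \<in> C. x \<in> A \<and> (\<exists>g \<in> carrier K. \<forall>y \<in> A. \<sigma> y = g y)"
    proof cases
      case 1 then show ?thesis using A g on_A by blast
    next
      case 2 then show ?thesis using AX(3) g on_gA(1) by (intro bexI[of _ "g ` A"]) auto
    next
      case 3 then show ?thesis
        using AX(3) A off by (intro bexI[of _ "X - A - g ` A"] conjI bexI[of _ \<one>]) auto
    qed
  qed
  then have "\<sigma> \<in> supported (A \<union> g ` A)" using off by (simp add: supported_def)
  then show thesis using that on_A invol by blast
qed

lemma restrict_to:
  assumes g: "g \<in> carrier K" and B: "B \<in> C" and stable: "g ` B = B"
  obtains \<tau> where "\<tau> \<in> supported B" "\<And>x. x \<in> B \<Longrightarrow> \<tau> x = g x"
proof -
  define \<tau> where "\<tau> = (\<lambda>x \<in> X. if x \<in> B then g x else x)"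
  have BX: "B \<subseteq> X" using B by (rule clopen_subset)
  have "bij_betw g B B"
    using stable apply_inj[OF g] BX by (auto simp: bij_betw_def inj_on_def)
  then have "bij_betw \<tau> B B"
    by (rule bij_betw_cong[THEN iffD1, rotated]) (use BX in \<open>auto simp: \<tau>_def\<close>)
  moreover have "bij_betw \<tau> (X - B) (X - B)"
    by (rule bij_betw_cong[THEN iffD1, rotated, OF bij_betw_id]) (auto simp: \<tau>_def)
  ultimately have "bij_betw \<tau> (B \<union> (X - B)) (B \<union> (X - B))"
    by (rule bij_betw_combine) auto
  then have "\<tau> \<in> Bij X" using BX by (simp add: Bij_def \<tau>_def Un_absorb1)
  then have "\<tau> \<in> carrier K"
  proof (rule glue)
    fix x assume x: "x \<in> X"
    show "\<exists>A \<in> C. x \<in> A \<and> (\<exists>g \<in> carrier K. \<forall>y \<in> A. \<tau> y = g y)"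
    proof (cases "x \<in> B")
      case True
      then show ?thesis using B g BX by (intro bexI[of _ B] conjI bexI[of _ g]) (auto simp: \<tau>_def)
    next
      case False
      then show ?thesis
        using B x by (intro bexI[of _ "X - B"] conjI bexI[of _ \<one>]) (auto simp: \<tau>_def)
    qed
  qed
  then have "\<tau> \<in> supported B" by (simp add: supported_def \<tau>_def)
  then show thesis using BX by (intro that[of \<tau>]) (auto simp: \<tau>_def)
qed

subsection \<open>Fragmentation\<close>

text \<open>
  The finite set \<open>F\<close> of points of \<open>X\<close> controls covering rather than mass: if \<open>F\<close> has more than \<open>n\<close> points, then \<open>n\<close> tiny
  sets cannot cover \<open>X\<close>.  The bound on masses does not exclude this when \<open>M\<close> is empty.
\<close>

definition tiny :: "real \<Rightarrow> 'a set \<Rightarrow> 'a set \<Rightarrow> bool" where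
  "tiny \<epsilon> F A \<longleftrightarrow> A \<in> C \<and> (\<forall>m \<in> M. m A < \<epsilon>) \<and> card (A \<inter> F) \<le> 1"

definition fragments :: "real \<Rightarrow> 'a set \<Rightarrow> ('a \<Rightarrow> 'a) set" where
  "fragments \<epsilon> F = {f. \<exists>A B. tiny \<epsilon> F A \<and> tiny \<epsilon> F B \<and> f \<in> supported (A \<union> B)}"

lemma fragments_carrier: "fragments \<epsilon> F \<subseteq> carrier K"
  by (auto simp: fragments_def supported_carrier)

lemma tiny_subset:
  assumes "tiny \<epsilon> F A" "B \<in> C" "B \<subseteq> A" "finite F"
  shows "tiny \<epsilon> F B"
proof -
  have "m B < \<epsilon>" if "m \<in> M" for m
    using assms mass_mono[OF that, of B A] that by (fastforce simp: tiny_def)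
  moreover have "card (B \<inter> F) \<le> card (A \<inter> F)"
    using assms by (intro card_mono) auto
  ultimately show ?thesis using assms by (auto simp: tiny_def)
qed

lemma tiny_neighbourhood:
  assumes "x \<in> A" "A \<in> C" "\<epsilon> > 0" "finite F" "F \<subseteq> X"
  obtains V where "tiny \<epsilon> F V" "x \<in> V" "V \<subseteq> A"
proof -
  obtain V where V: "V \<in> C" "x \<in> V" "V \<subseteq> A" "V \<inter> F \<subseteq> {x}" "\<And>m. m \<in> M \<Longrightarrow> m V < \<epsilon>"
    using small_neighbourhood[OF assms] by blast
  have "card (V \<inter> F) \<le> card {x}" using V(4) by (intro card_mono) auto
  then have "tiny \<epsilon> F V" using V by (simp add: tiny_def)
  then show thesis using V(2,3) by (rule that)
qed

text \<open>
  An involution swapping \<open>A\<close> and \<open>\<sigma> A\<close> is the product of its restrictions to \<open>V \<union> \<sigma> V\<close>, where \<open>V\<close> runs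
  through a partition of \<open>A\<close> so fine that \<open>V\<close> and \<open>\<sigma> V\<close> are both tiny.
\<close>

lemma swap_generated:
  assumes \<epsilon>: "\<epsilon> > 0" and F: "finite F" "F \<subseteq> X"
    and \<sigma>: "\<sigma> \<in> supported (A \<union> \<sigma> ` A)" and A: "A \<in> C"
    and disj: "A \<inter> \<sigma> ` A = {}"
    and invol: "\<And>x. x \<in> X \<Longrightarrow> \<sigma> (\<sigma> x) = x"
  shows "\<sigma> \<in> generate K (fragments \<epsilon> F)"
proof -
  let ?H = "generate K (fragments \<epsilon> F)"
  let ?S = "\<lambda>W. (A \<inter> W) \<union> \<sigma> ` (A \<inter> W)"
  have K: "\<sigma> \<in> carrier K" using \<sigma> by (rule supported_carrier)
  have S_clopen: "?S W \<in> C" if "W \<in> C" for W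
    using A that image_clopen[OF K] by simp
  have S_stable: "\<sigma> ` ?S W = ?S W" if "W \<in> C" for W
  proof -
    have "A \<inter> W \<subseteq> X" using clopen_subset A by blast
    then have "\<sigma> (\<sigma> x) = x" if "x \<in> A \<inter> W" for x using that invol by blast
    then have "(\<lambda>x. \<sigma> (\<sigma> x)) ` (A \<inter> W) = A \<inter> W" by (rule image_cong[OF refl, THEN trans]) auto
    then have "\<sigma> ` (\<sigma> ` (A \<inter> W)) = A \<inter> W" by (simp only: image_image)
    then show ?thesis by (auto simp: image_Un)
  qed
  let ?P = "\<lambda>W. \<forall>\<tau> \<in> supported (?S W). (\<forall>x \<in> ?S W. \<tau> x = \<sigma> x) \<longrightarrow> \<tau> \<in> ?H"
  have "?P X"
  proof (rule clopen_induct[where Q = "\<lambda>V. tiny \<epsilon> F V \<and> tiny \<epsilon> F (\<sigma> ` V)" and P = ?P])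
    fix x assume x: "x \<in> X"
    obtain V1 where V1: "tiny \<epsilon> F V1" "x \<in> V1"
      using tiny_neighbourhood[OF x clopen_ops(2) \<epsilon> F] by metis
    obtain V2 where V2: "tiny \<epsilon> F V2" "\<sigma> x \<in> V2"
      using tiny_neighbourhood[OF apply_in[OF K x] clopen_ops(2) \<epsilon> F] by metis
    have C12: "V1 \<in> C" "V2 \<in> C" using V1 V2 by (auto simp: tiny_def)
    let ?V = "V1 \<inter> \<sigma> ` V2"
    have "?V \<in> C" using C12 image_clopen[OF K] by auto
    moreover have "x \<in> ?V" using V1 V2 invol[OF x] by (metis IntI imageI)
    moreover have "\<sigma> ` ?V \<subseteq> V2"
      using invol clopen_subset[OF C12(2)] by auto
    ultimately have "tiny \<epsilon> F ?V" "tiny \<epsilon> F (\<sigma> ` ?V)"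
      by (intro tiny_subset[OF V1(1)] tiny_subset[OF V2(1)] F(1) image_clopen[OF K]; simp)+
    then show "\<exists>V \<in> C. x \<in> V \<and> tiny \<epsilon> F V \<and> tiny \<epsilon> F (\<sigma> ` V)"
      using \<open>?V \<in> C\<close> \<open>x \<in> ?V\<close> by (intro bexI[of _ ?V] conjI)
  next
    fix V W assume "V \<in> C" "W \<in> C" "tiny \<epsilon> F V \<and> tiny \<epsilon> F (\<sigma> ` V)" "W \<subseteq> V"
    then show "tiny \<epsilon> F W \<and> tiny \<epsilon> F (\<sigma> ` W)"
      by (metis tiny_subset F(1) image_clopen[OF K] image_mono)
  next
    have "\<tau> = \<one>" if "\<tau> \<in> supported (?S {})" for \<tau>
      using that supported_carrier[OF that] by (intro perm_eqI) (auto simp: supported_def)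
    then show "?P {}"
      using generate.one by blast
  next
    fix W V
    assume W: "W \<in> C" and V: "V \<in> C" and WV: "W \<inter> V = {}"
      and tinyV: "tiny \<epsilon> F V \<and> tiny \<epsilon> F (\<sigma> ` V)"
      and IH: "?P W"
    show "?P (W \<union> V)"
    proof (intro ballI impI)
      fix \<tau> assume \<tau>: "\<tau> \<in> supported (?S (W \<union> V))" and eq: "\<forall>x \<in> ?S (W \<union> V). \<tau> x = \<sigma> x"
      have S_Un: "?S (W \<union> V) = ?S W \<union> ?S V" by auto
      have stable: "\<tau> ` ?S V = ?S V" "\<tau> ` ?S W = ?S W"
        using eq S_stable[OF V] S_stable[OF W] unfolding S_Un by (metis UnCI image_cong)+
      note \<tau>K = supported_carrier[OF \<tau>]
      obtain \<tau>V where \<tau>V: "\<tau>V \<in> supported (?S V)" "\<And>x. x \<in> ?S V \<Longrightarrow> \<tau>V x = \<tau> x"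
        using restrict_to[OF \<tau>K S_clopen[OF V] stable(1)] by blast
      have \<tau>V_H: "\<tau>V \<in> ?H"
      proof (rule generate.incl)
        show "\<tau>V \<in> fragments \<epsilon> F"
        proof -
          have "?S V \<subseteq> V \<union> \<sigma> ` V" by blast
          then show ?thesis using tinyV supported_mono[OF \<tau>V(1)] unfolding fragments_def by blast
        qed
      qed
      note \<tau>VK = supported_carrier[OF \<tau>V(1)]
      define \<rho> where "\<rho> = \<tau> \<otimes> inv \<tau>V"
      have SX: "?S V \<subseteq> X" "?S W \<subseteq> X" using S_clopen[OF V] S_clopen[OF W] clopen_subset by blast+
      have "\<sigma> ` (A \<inter> W) \<inter> \<sigma> ` (A \<inter> V) = {}"
        using WV apply_inj[OF K] clopen_subset[OF A] by blast
      then have S_disj: "?S W \<inter> ?S V = {}" using WV disj by blast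
      have \<rho>_V: "\<rho> x = x" if x: "x \<in> ?S V" for x
      proof -
        have xX: "x \<in> X" using SX x by blast
        have "(inv \<tau>V) x \<in> ?S V" by (rule supported_stable[OF supported_inv[OF \<tau>V(1)] xX x])
        then have "\<tau> ((inv \<tau>V) x) = x" using apply_inv_right[OF \<tau>VK xX] \<tau>V(2) by metis
        then show ?thesis using xX \<tau>K \<tau>VK by (simp add: \<rho>_def apply_mult)
      qed
      have \<rho>_off: "\<rho> x = \<tau> x" if x: "x \<in> X" "x \<notin> ?S V" for x
        using supported_fix[OF supported_inv[OF \<tau>V(1)] x] x \<tau>K \<tau>VK by (simp add: \<rho>_def apply_mult)
      have "\<rho> \<in> ?H"
      proof (rule IH[THEN bspec, THEN mp])
        show "\<forall>x \<in> ?S W. \<rho> x = \<sigma> x"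
        proof
          fix x assume x: "x \<in> ?S W"
          then have "x \<in> X" "x \<notin> ?S V" using SX S_disj by blast+
          then show "\<rho> x = \<sigma> x" using \<rho>_off eq x unfolding S_Un by simp
        qed
        have "\<rho> x = x" if "x \<in> X - ?S W" for x
        proof (cases "x \<in> ?S V")
          case True then show ?thesis by (rule \<rho>_V)
        next
          case False
          then show ?thesis using that \<rho>_off supported_fix[OF \<tau>, of x] unfolding S_Un by simp
        qed
        then show "\<rho> \<in> supported (?S W)"
          using \<tau>K \<tau>VK unfolding supported_def \<rho>_def by simp
      qed
      moreover have "\<tau> = \<rho> \<otimes> \<tau>V" using \<tau>K \<tau>VK by (simp add: \<rho>_def m_assoc)
      ultimately show "\<tau> \<in> ?H" using \<tau>V_H generate.eng by metis
    qed
  qed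
  then show ?thesis
    using \<sigma> clopen_subset[OF A] by (simp add: Int_absorb2)
qed

text \<open>
  Moving \<open>V\<close> into the spare set \<open>R\<close> and from there to \<open>f V\<close> gives \<open>f\<close> on \<open>V\<close> as a product of two swaps.  The
  detour makes the argument independent of how \<open>V\<close> and \<open>f V\<close> overlap.
\<close>

lemma match_on:
  assumes \<epsilon>: "\<epsilon> > 0" and F: "finite F" "F \<subseteq> X"
    and f: "f \<in> carrier K" and V: "V \<in> C" and R: "R \<in> C" "R \<noteq> {}"
    and disj: "R \<inter> V = {}" "R \<inter> f ` V = {}" and less: "\<And>m. m \<in> M \<Longrightarrow> m V < m R"
  obtains s where "s \<in> generate K (fragments \<epsilon> F)" "s \<in> supported (V \<union> f ` V \<union> R)"
    "\<And>x. x \<in> V \<Longrightarrow> s x = f x"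
proof -
  let ?H = "generate K (fragments \<epsilon> F)"
  have VX: "V \<subseteq> X" using V by (rule clopen_subset)
  obtain g where g: "g \<in> carrier K" "g ` V \<subseteq> R"
    using comparison[OF V R(1) _ R(2) less] disj by blast
  have "V \<inter> g ` V = {}" using g disj by blast
  then obtain \<sigma> where \<sigma>: "\<sigma> \<in> supported (V \<union> g ` V)" "\<And>x. x \<in> V \<Longrightarrow> \<sigma> x = g x"
    "\<And>x. x \<in> X \<Longrightarrow> \<sigma> (\<sigma> x) = x"
    using swap_on[OF g(1) V] by blast
  have \<sigma>V: "\<sigma> ` V = g ` V" by (rule image_cong[OF refl \<sigma>(2)])
  note \<sigma>K = supported_carrier[OF \<sigma>(1)]
  have \<sigma>_H: "\<sigma> \<in> ?H"
    using swap_generated[OF \<epsilon> F _ V _ \<sigma>(3)] \<sigma>(1) \<open>V \<inter> g ` V = {}\<close> unfolding \<sigma>V by blast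
  define h where "h = f \<otimes> \<sigma>"
  have h: "h \<in> carrier K" using f \<sigma>K by (simp add: h_def)
  have A: "g ` V \<in> C" using image_clopen g V by blast
  have h_on: "h (g x) = f x" if "x \<in> V" for x
  proof -
    have "x \<in> X" using that VX by blast
    then show ?thesis
      using \<sigma>(2)[OF that] \<sigma>(3)[of x] apply_mult[OF f \<sigma>K, of "g x"] apply_in[OF g(1)] by (simp add: h_def)
  qed
  have hA: "h ` (g ` V) = f ` V"
    unfolding image_image by (rule image_cong[OF refl h_on])
  have disj2: "g ` V \<inter> h ` (g ` V) = {}" unfolding hA using g disj by blast
  obtain \<tau> where \<tau>: "\<tau> \<in> supported (g ` V \<union> h ` (g ` V))" "\<And>x. x \<in> g ` V \<Longrightarrow> \<tau> x = h x"
    "\<And>x. x \<in> X \<Longrightarrow> \<tau> (\<tau> x) = x"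
    using swap_on[OF h A disj2] by blast
  have \<tau>A: "\<tau> ` (g ` V) = h ` (g ` V)" by (rule image_cong[OF refl \<tau>(2)])
  have \<tau>_H: "\<tau> \<in> ?H"
    using swap_generated[OF \<epsilon> F _ A _ \<tau>(3)] \<tau>(1) disj2 unfolding \<tau>A by blast
  show thesis
  proof (rule that[of "\<tau> \<otimes> \<sigma>"])
    show "\<tau> \<otimes> \<sigma> \<in> ?H" using \<sigma>_H \<tau>_H by (rule generate.eng[rotated])
    show "\<tau> \<otimes> \<sigma> \<in> supported (V \<union> f ` V \<union> R)"
      using g(2) hA supported_mono[OF \<sigma>(1), of "V \<union> f ` V \<union> R"] supported_mono[OF \<tau>(1), of "V \<union> f ` V \<union> R"]
      by (intro supported_mult) auto
    show "(\<tau> \<otimes> \<sigma>) x = f x" if "x \<in> V" for x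
    proof -
      have "x \<in> X" "g x \<in> g ` V" using that VX by auto
      then show ?thesis
        using \<sigma>(2)[OF that] \<tau>(2)[of "g x"] h_on[OF that] apply_mult[OF supported_carrier[OF \<tau>(1)] \<sigma>K, of x]
        by simp
    qed
  qed
qed

text \<open>
  Fix a tiny set \<open>T\<close> as a reservoir of spare sets and partition the rest of the space into pieces \<open>V\<close> with
  less than a quarter of the mass of \<open>T\<close>.  Correcting \<open>f\<close> by fragments makes it the identity on more and
  more of the pieces, until it lives on \<open>T\<close>.  The spare set for a piece \<open>V\<close> is taken from \<open>T\<close> minus the
  image of \<open>V\<close>, so its mass is sufficient; in the absence of measures that difference might be empty.
  Therefore the induction also keeps a nonempty clopen part \<open>U\<close> of \<open>T\<close> on which the element is the
  identity: the image of \<open>V\<close> avoids \<open>U\<close>, and half of \<open>U\<close> may be spent at every step.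
\<close>

lemma generate_fragments:
  assumes \<epsilon>: "\<epsilon> > 0" and F: "finite F" "F \<subseteq> X"
  shows "generate K (fragments \<epsilon> F) = carrier K"
proof
  let ?H = "generate K (fragments \<epsilon> F)"
  have H_group: "subgroup ?H K" by (rule generate_is_subgroup[OF fragments_carrier])
  have H_carrier: "h \<in> carrier K" if "h \<in> ?H" for h using subgroup.mem_carrier[OF H_group that] .
  then show "?H \<subseteq> carrier K" by blast
  show "carrier K \<subseteq> ?H"
  proof
    fix f assume f: "f \<in> carrier K"
    obtain x where x: "x \<in> X" using nonempty by blast
    obtain T where T: "tiny \<epsilon> F T" "x \<in> T" using tiny_neighbourhood[OF x clopen_ops(2) \<epsilon> F] by metis
    have TC: "T \<in> C" using T by (simp add: tiny_def)
    have TX: "T \<subseteq> X" using TC by (rule clopen_subset)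
    have "T \<noteq> {}" using T by auto
    from mass_lower_bound[OF TC this] obtain \<delta> where \<delta>: "\<delta> > 0" "\<And>m. m \<in> M \<Longrightarrow> \<delta> \<le> m T" by blast
    define Q where "Q V \<longleftrightarrow> (\<forall>m \<in> M. 4 * m V < m T)" for V
    have Q_subset: "Q W" if "V \<in> C" "W \<in> C" "Q V" "W \<subseteq> V" for V W
      using that mass_mono[of _ W V] unfolding Q_def by (meson mult_le_cancel_left_pos order_le_less_trans zero_less_numeral)
    have Q_local: "\<exists>V \<in> C. y \<in> V \<and> V \<subseteq> A \<and> V \<inter> E \<subseteq> {y} \<and> Q V"
      if y: "y \<in> A" "A \<in> C" and E: "finite E" "E \<subseteq> X" for y A E
    proof -
      obtain V where V: "V \<in> C" "y \<in> V" "V \<subseteq> A" "V \<inter> E \<subseteq> {y}" "\<And>m. m \<in> M \<Longrightarrow> m V < \<delta> / 4"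
        using small_neighbourhood[OF y _ E, of "\<delta> / 4"] \<delta>(1) by auto
      moreover have "Q V" using V(5) \<delta>(2) unfolding Q_def by fastforce
      ultimately show ?thesis by blast
    qed
    let ?P = "\<lambda>W. \<exists>h \<in> ?H. \<exists>U \<in> C. U \<noteq> {} \<and> U \<subseteq> T \<and> Q U \<and> (\<forall>x \<in> (W - T) \<union> U. (h \<otimes> f) x = x)"
    have "?P X"
    proof (rule clopen_induct[where Q = Q and P = ?P])
      show "\<exists>V \<in> C. y \<in> V \<and> Q V" if "y \<in> X" for y using Q_local[OF that, of "{}"] by auto
      show "Q W" if "V \<in> C" "W \<in> C" "Q V" "W \<subseteq> V" for V W using that by (rule Q_subset)
      have "infinite X" by (rule infinite_X)
      then have "infinite (X - {x, f x})" by simp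
      then obtain y where y: "y \<in> X" "y \<noteq> x" "y \<noteq> f x"
        by (metis Diff_iff finite.emptyI insert_iff ex_in_conv)
      have fy: "(inv f) y \<in> X" "(inv f) y \<noteq> x" using f y x by auto
      obtain V where V: "V \<in> C" "x \<in> V" "V \<subseteq> T" "V \<inter> {y, (inv f) y} \<subseteq> {x}" "Q V"
        using Q_local[OF T(2) TC, of "{y, (inv f) y}"] fy y by auto
      define R where "R = X - V - f ` V"
      have "y \<in> R"
        using V(4) y fy mem_image_iff[OF f clopen_subset[OF V(1)] y(1)] by (auto simp: R_def)
      have fV: "f ` V \<in> C" using image_clopen f V by blast
      have "m V < m R" if m: "m \<in> M" for m
      proof -
        have "m (X - V - f ` V) \<ge> m X - m V - m (f ` V)"
          using mass_Diff_ge[OF m, of X V] mass_Diff_ge[OF m, of "X - V" "f ` V"] V fV by simp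
        moreover have "m (f ` V) = m V" using mass_image m f V by blast
        moreover have "4 * m V < m T" using V(5) m by (simp add: Q_def)
        moreover have "m T \<le> m X" using mass_mono[OF m TC _ TX] by simp
        moreover have "m X = 1" by (rule mass_total[OF m])
        ultimately show ?thesis unfolding R_def by linarith
      qed
      then obtain s where s: "s \<in> ?H" "\<And>x. x \<in> V \<Longrightarrow> s x = f x"
        using match_on[OF \<epsilon> F f V(1), of R] V(1) fV \<open>y \<in> R\<close> unfolding R_def
        by (metis clopen_ops(2,5) Diff_disjoint Diff_eq_empty_iff Int_commute Int_Diff empty_iff inf.cobounded2)
      have "(inv s \<otimes> f) z = z" if "z \<in> V" for z
      proof -
        have "z \<in> X" using that V(1) clopen_subset by blast
        then show ?thesis
          using apply_mult[OF inv_closed[OF H_carrier[OF s(1)]] f] s(2)[OF that, symmetric]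
            H_carrier[OF s(1)] by simp
      qed
      moreover have "inv s \<in> ?H" using s(1) by (rule subgroup.m_inv_closed[OF H_group])
      ultimately show "?P {}"
        using V by (intro bexI[of _ "inv s"] bexI[of _ V]) auto
    next
      fix W V
      assume W: "W \<in> C" and V: "V \<in> C" "Q V" and WV: "W \<inter> V = {}"
        and "?P W"
      then obtain h U where h: "h \<in> ?H" and U: "U \<in> C" "U \<noteq> {}" "U \<subseteq> T" "Q U"
        and fix_hf: "\<And>x. x \<in> (W - T) \<union> U \<Longrightarrow> (h \<otimes> f) x = x" by blast
      define b where "b = h \<otimes> f"
      have b: "b \<in> carrier K" using H_carrier[OF h] f by (simp add: b_def)
      have b_fix: "b x = x" if "x \<in> (W - T) \<union> U" for x using fix_hf[OF that] by (simp add: b_def)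
      obtain U1 U2 where U12: "U1 \<in> C" "U2 \<in> C" "U1 \<noteq> {}" "U2 \<noteq> {}" "U1 \<inter> U2 = {}" "U1 \<subseteq> U" "U2 \<subseteq> U"
        using split_clopen[OF U(1,2)] by metis
      define V' where "V' = V - T"
      define R where "R = T - b ` V' - U1"
      have V': "V' \<in> C" "V' \<subseteq> X" "V' \<inter> ((W - T) \<union> U) = {}" "Q V'"
        using V W WV TC U(3) clopen_subset[OF V(1)] Q_subset[OF V(1) _ V(2)] by (auto simp: V'_def)
      have WU: "(W - T) \<union> U \<subseteq> X" using W U(1) clopen_subset by blast
      have bV': "b ` V' \<in> C" "b ` V' \<inter> ((W - T) \<union> U) = {}"
      proof -
        show "b ` V' \<in> C" using image_clopen b V' by blast
        show "b ` V' \<inter> ((W - T) \<union> U) = {}"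
        proof (rule ccontr)
          assume "b ` V' \<inter> ((W - T) \<union> U) \<noteq> {}"
          then obtain v where v: "v \<in> V'" "b v \<in> (W - T) \<union> U" by blast
          then have "b (b v) = b v" using b_fix by blast
          then have "b v = v" using apply_inj[OF b] v V'(2) WU by blast
          then show False using v V'(3) by auto
        qed
      qed
      have R: "R \<in> C" "R \<noteq> {}" "R \<inter> V' = {}" "R \<inter> b ` V' = {}"
      proof -
        have "U2 \<subseteq> R" using U12 U(3) bV'(2) by (auto simp: R_def)
        then show "R \<noteq> {}" using U12 by blast
        show "R \<in> C" using TC bV' U12 by (simp add: R_def)
      qed (auto simp: R_def V'_def)
      have "m V' < m R" if m: "m \<in> M" for m
      proof -
        have "m R \<ge> m T - m (b ` V') - m U1"
          using mass_Diff_ge[OF m, of T "b ` V'"] mass_Diff_ge[OF m, of "T - b ` V'" U1] TC bV' U12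
          unfolding R_def by simp
        moreover have "m (b ` V') = m V'" using mass_image m b V' by blast
        moreover have "4 * m V' < m T" "4 * m U1 < m T"
          using V'(4) Q_subset[OF U(1) U12(1) U(4) U12(6)] m by (auto simp: Q_def)
        moreover have "0 \<le> m V'" using m V' mass_nonneg by blast
        ultimately show ?thesis by linarith
      qed
      then obtain s where s: "s \<in> ?H" "s \<in> supported (V' \<union> b ` V' \<union> R)" "\<And>x. x \<in> V' \<Longrightarrow> s x = b x"
        using match_on[OF \<epsilon> F b V'(1) R] by blast
      note sK = H_carrier[OF s(1)]
      have new: "(inv s \<otimes> b) x = x" if x: "x \<in> ((W \<union> V) - T) \<union> U1" for x
      proof (cases "x \<in> V'")
        case True
        then have "x \<in> X" using V'(2) by blast
        then show ?thesis using apply_mult[OF inv_closed[OF sK] b] s(3)[OF True, symmetric] sK by simp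
      next
        case False
        then have x': "x \<in> (W - T) \<union> U" "x \<in> X" "x \<notin> R" using x U12 WU by (auto simp: V'_def R_def)
        then have "x \<notin> V' \<union> b ` V' \<union> R" using False bV' by blast
        then have "(inv s) x = x" using supported_fix[OF supported_inv[OF s(2)] x'(2)] by blast
        then show ?thesis using apply_mult[OF inv_closed[OF sK] b x'(2)] b_fix[OF x'(1)] by simp
      qed
      have "inv s \<otimes> h \<in> ?H"
        using s(1) h by (intro subgroup.m_closed[OF H_group] subgroup.m_inv_closed[OF H_group])
      moreover have "(inv s \<otimes> h) \<otimes> f = inv s \<otimes> b" using sK H_carrier[OF h] f by (simp add: b_def m_assoc)
      moreover have "Q U1" using Q_subset[OF U(1) U12(1) U(4) U12(6)] .
      ultimately show "?P (W \<union> V)"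
        using U12 U(3) new by (intro bexI[of _ "inv s \<otimes> h"] bexI[of _ U1]) auto
    qed
    then obtain h where h: "h \<in> ?H" "\<And>x. x \<in> X - T \<Longrightarrow> (h \<otimes> f) x = x" by blast
    have "h \<otimes> f \<in> supported (T \<union> T)" using h H_carrier f by (simp add: supported_def)
    then have "h \<otimes> f \<in> ?H" using T(1) unfolding fragments_def by (intro generate.incl) blast
    then have "inv h \<otimes> (h \<otimes> f) \<in> ?H"
      by (rule subgroup.m_closed[OF H_group subgroup.m_inv_closed[OF H_group h(1)]])
    then show "f \<in> ?H" using H_carrier[OF h(1)] f by simp
  qed
qed

subsection \<open>Moving small sets by commutators\<close>

text \<open>
  With swaps \<open>\<sigma>\<close> of \<open>A\<close> into \<open>B\<close> and \<open>\<tau>\<close> of \<open>A\<close> into \<open>B'\<close>, the commutator acts on \<open>A\<close> as \<open>\<sigma>\<close>: the inverse of \<open>\<tau>\<close>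
  moves \<open>A\<close> out of the support of \<open>\<sigma>\<close> and \<open>\<tau>\<close> brings it back.
\<close>

lemma commutator_move:
  assumes A: "A \<in> C" and B: "B \<in> C" "B \<noteq> {}" "A \<inter> B = {}" "\<And>m. m \<in> M \<Longrightarrow> m A < m B"
    and B': "B' \<in> C" "B' \<noteq> {}" "A \<inter> B' = {}" "\<And>m. m \<in> M \<Longrightarrow> m A < m B'"
    and disj: "B \<inter> B' = {}"
  obtains h where "h \<in> derived K (carrier K)" "h ` A \<subseteq> B"
proof -
  have AX: "A \<subseteq> X" using A by (rule clopen_subset)
  obtain g where g: "g \<in> carrier K" "g ` A \<subseteq> B" using comparison[OF A B(1,3,2,4)] by blast
  obtain g' where g': "g' \<in> carrier K" "g' ` A \<subseteq> B'" using comparison[OF A B'(1,3,2,4)] by blast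
  have "A \<inter> g ` A = {}" "A \<inter> g' ` A = {}" using g g' B B' by blast+
  obtain \<sigma> where \<sigma>: "\<sigma> \<in> supported (A \<union> g ` A)" "\<And>x. x \<in> A \<Longrightarrow> \<sigma> x = g x"
    "\<And>x. x \<in> X \<Longrightarrow> \<sigma> (\<sigma> x) = x"
    using swap_on[OF g(1) A \<open>A \<inter> g ` A = {}\<close>] by blast
  obtain \<tau> where \<tau>: "\<tau> \<in> supported (A \<union> g' ` A)" "\<And>x. x \<in> A \<Longrightarrow> \<tau> x = g' x"
    "\<And>x. x \<in> X \<Longrightarrow> \<tau> (\<tau> x) = x"
    using swap_on[OF g'(1) A \<open>A \<inter> g' ` A = {}\<close>] by blast
  note K = supported_carrier[OF \<sigma>(1)] supported_carrier[OF \<tau>(1)]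
  have "commutator K \<sigma> \<tau> x \<in> B" if x: "x \<in> A" for x
  proof -
    have X: "x \<in> X" "\<tau> x \<in> X" using x AX apply_in[OF K(2)] by auto
    have "(inv \<tau>) x = \<tau> x" using apply_inv_left[OF K(2) X(2)] \<tau>(3)[OF X(1)] by simp
    moreover have "\<tau> x \<in> B'" using \<tau>(2)[OF x] g'(2) x by auto
    then have "\<sigma> (\<tau> x) = \<tau> x"
      using B'(3) disj g(2) by (intro supported_fix[OF \<sigma>(1) X(2)]) blast
    then have "(inv \<sigma>) (\<tau> x) = \<tau> x" using apply_inv_left[OF K(1) X(2)] by simp
    moreover have "\<sigma> x \<in> B" using \<sigma>(2)[OF x] g(2) x by auto
    ultimately show ?thesis
      using K X \<tau>(3)[OF X(1)] by (simp add: commutator_def apply_mult apply_in)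
  qed
  then have "commutator K \<sigma> \<tau> ` A \<subseteq> B" by blast
  then show thesis using that commutator_in_derived[OF K] by blast
qed

text \<open>
  If there is an invariant mass, the two halves of \<open>U\<close>, with \<open>Z\<close> removed, are still large enough to serve as
  targets.  Otherwise every nonempty clopen set off \<open>Z\<close> is a target; when \<open>U\<close> lies inside \<open>Z\<close>, first
  \<open>Z\<close> is moved into its complement.
\<close>

lemma derived_move:
  assumes U: "U \<in> C" "U \<noteq> {}"
  obtains \<epsilon> :: real where "\<epsilon> > 0"
    "\<And>Z. Z \<in> C \<Longrightarrow> Z \<noteq> X \<Longrightarrow> (\<And>m. m \<in> M \<Longrightarrow> m Z < \<epsilon>) \<Longrightarrow> \<exists>h \<in> derived K (carrier K). h ` Z \<subseteq> U"
proof -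
  have D: "subgroup (derived K (carrier K)) K" by (rule derived_is_subgroup) simp
  obtain P Q where PQ: "P \<in> C" "Q \<in> C" "P \<noteq> {}" "Q \<noteq> {}" "P \<inter> Q = {}" "P \<subseteq> U" "Q \<subseteq> U"
    using split_clopen[OF U] by metis
  obtain \<delta>P where \<delta>P: "\<delta>P > 0" "\<And>m. m \<in> M \<Longrightarrow> \<delta>P \<le> m P" using mass_lower_bound[OF PQ(1,3)] by blast
  obtain \<delta>Q where \<delta>Q: "\<delta>Q > 0" "\<And>m. m \<in> M \<Longrightarrow> \<delta>Q \<le> m Q" using mass_lower_bound[OF PQ(2,4)] by blast
  define \<epsilon> where "\<epsilon> = min \<delta>P \<delta>Q / 2"
  have "\<exists>h \<in> derived K (carrier K). h ` Z \<subseteq> U"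
    if Z: "Z \<in> C" "Z \<noteq> X" and small: "\<And>m. m \<in> M \<Longrightarrow> m Z < \<epsilon>" for Z
  proof (cases "M = {}")
    case True
    have move: "\<exists>h \<in> derived K (carrier K). h ` A \<subseteq> R"
      if A: "A \<in> C" and R: "R \<in> C" "R \<noteq> {}" "A \<inter> R = {}" for A R
    proof -
      obtain R1 R2 where "R1 \<in> C" "R2 \<in> C" "R1 \<noteq> {}" "R2 \<noteq> {}" "R1 \<inter> R2 = {}" "R1 \<subseteq> R" "R2 \<subseteq> R"
        using split_clopen[OF R(1,2)] by metis
      moreover from this R(3) have "A \<inter> R1 = {}" "A \<inter> R2 = {}" by blast+
      ultimately obtain h where "h \<in> derived K (carrier K)" "h ` A \<subseteq> R1"
        using commutator_move[OF A, of R1 R2] True by blast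
      then show ?thesis using \<open>R1 \<subseteq> R\<close> by blast
    qed
    show ?thesis
    proof (cases "U \<subseteq> Z")
      case False
      then show ?thesis using move[of Z "U - Z"] U Z by auto
    next
      case True
      have "X - Z \<noteq> {}" using Z clopen_subset by blast
      then obtain h1 where h1: "h1 \<in> derived K (carrier K)" "h1 ` Z \<subseteq> X - Z"
        using move[of Z "X - Z"] Z by auto
      note h1K = subgroup.mem_carrier[OF D h1(1)]
      have "h1 ` Z \<in> C" using image_clopen h1K Z by blast
      moreover have "h1 ` Z \<inter> U = {}" using h1(2) True by blast
      ultimately obtain h2 where h2: "h2 \<in> derived K (carrier K)" "h2 ` (h1 ` Z) \<subseteq> U"
        using move[of "h1 ` Z" U] U by blast
      have "(h2 \<otimes> h1) ` Z \<subseteq> U"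
        using h2(2) image_mult[OF subgroup.mem_carrier[OF D h2(1)] h1K clopen_subset[OF Z(1)]] by simp
      then show ?thesis using subgroup.m_closed[OF D h2(1) h1(1)] by blast
    qed
  next
    case False
    have P: "m Z < m (P - Z)" if m: "m \<in> M" for m
      using small[OF m] \<delta>P(2)[OF m] mass_Diff_ge[OF m PQ(1) Z(1)] by (simp add: \<epsilon>_def)
    have Q: "m Z < m (Q - Z)" if m: "m \<in> M" for m
      using small[OF m] \<delta>Q(2)[OF m] mass_Diff_ge[OF m PQ(2) Z(1)] by (simp add: \<epsilon>_def)
    obtain m where m: "m \<in> M" using False by blast
    have neP: "P - Z \<noteq> {}"
    proof
      assume empty: "P - Z = {}"
      show False using P[OF m] mass_nonneg[OF m Z(1)] mass_empty[OF m] unfolding empty by simp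
    qed
    have neQ: "Q - Z \<noteq> {}"
    proof
      assume empty: "Q - Z = {}"
      show False using Q[OF m] mass_nonneg[OF m Z(1)] mass_empty[OF m] unfolding empty by simp
    qed
    have PZ: "P - Z \<in> C" "Q - Z \<in> C" "Z \<inter> (P - Z) = {}" "Z \<inter> (Q - Z) = {}" "(P - Z) \<inter> (Q - Z) = {}"
      using PQ Z by auto
    obtain h where "h \<in> derived K (carrier K)" "h ` Z \<subseteq> P - Z"
      using commutator_move[OF Z(1) PZ(1) neP PZ(3) P PZ(2) neQ PZ(4) Q PZ(5)] by blast
    then show ?thesis using PQ(6) by blast
  qed
  then show thesis using that[of \<epsilon>] \<delta>P(1) \<delta>Q(1) by (simp add: \<epsilon>_def)
qed


subsection \<open>Simplicity\<close>

text \<open>Here \<open>[f, g] = [[f, \<alpha>], g]\<close>, because \<open>\<alpha> f\<^sup>-\<^sup>1 \<alpha>\<^sup>-\<^sup>1\<close> lives on \<open>\<alpha> U\<close> and so commutes with \<open>g\<close>.\<close>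

lemma commutator_of_derived_in_normal:
  assumes N: "subgroup N K"
    and conj: "\<And>n d. n \<in> N \<Longrightarrow> d \<in> derived K (carrier K) \<Longrightarrow> d \<otimes> n \<otimes> inv d \<in> N"
    and \<alpha>: "\<alpha> \<in> N" and U: "U \<subseteq> X" "U \<inter> \<alpha> ` U = {}"
    and f: "f \<in> derived K (carrier K)" "f \<in> supported U"
    and g: "g \<in> derived K (carrier K)" "g \<in> supported U"
  shows "commutator K f g \<in> N"
proof -
  note K = subgroup.mem_carrier[OF N \<alpha>] supported_carrier[OF f(2)] supported_carrier[OF g(2)]
  define f' where "f' = \<alpha> \<otimes> inv f \<otimes> inv \<alpha>"
  have "f' \<in> supported (\<alpha> ` U)"
    unfolding f'_def by (rule supported_conj[OF supported_inv[OF f(2)] K(1) U(1)])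
  then have comm: "f' \<otimes> g = g \<otimes> f'" using supported_commute[OF _ g(2)] U(2) by blast
  have f'K: "f' \<in> carrier K" using K by (simp add: f'_def)
  have "f \<otimes> \<alpha> \<otimes> inv f \<in> N" using conj[OF \<alpha> f(1)] .
  then have "f \<otimes> \<alpha> \<otimes> inv f \<otimes> inv \<alpha> \<in> N"
    using subgroup.m_closed[OF N] subgroup.m_inv_closed[OF N \<alpha>] by blast
  then have n: "f \<otimes> f' \<in> N" using K by (simp add: f'_def m_assoc)
  have "commutator K f g = commutator K (f \<otimes> f') g"
    by (rule commutator_absorb_left[OF K(2) f'K K(3) comm, symmetric])
  also have "\<dots> = (f \<otimes> f') \<otimes> (g \<otimes> inv (f \<otimes> f') \<otimes> inv g)"
    using K f'K by (simp add: commutator_def m_assoc)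
  also have "\<dots> \<in> N"
    by (rule subgroup.m_closed[OF N n conj[OF subgroup.m_inv_closed[OF N n] g(1)]])
  finally show ?thesis .
qed

text \<open>
  The copies of \<open>V\<close> make it possible to replace \<open>a\<close> and \<open>b\<close> by the commutators \<open>[a, k]\<close> and \<open>[b, l]\<close>: these are
  products of \<open>a\<close> and \<open>b\<close> with elements that live on \<open>k V\<close> and \<open>l V\<close> and disappear from \<open>[a, b]\<close>.
\<close>

lemma commutator_in_normal:
  assumes N: "subgroup N K"
    and conj: "\<And>n d. n \<in> N \<Longrightarrow> d \<in> derived K (carrier K) \<Longrightarrow> d \<otimes> n \<otimes> inv d \<in> N"
    and \<alpha>: "\<alpha> \<in> N" and U: "U \<subseteq> X" "U \<inter> \<alpha> ` U = {}"
    and k: "k \<in> carrier K" and l: "l \<in> carrier K"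
    and V: "V \<subseteq> U" "k ` V \<subseteq> U" "l ` V \<subseteq> U" "V \<inter> k ` V = {}" "V \<inter> l ` V = {}" "k ` V \<inter> l ` V = {}"
    and a: "a \<in> supported V" and b: "b \<in> supported V"
  shows "commutator K a b \<in> N"
proof -
  note K = supported_carrier[OF a] supported_carrier[OF b]
  have VX: "V \<subseteq> X" using V(1) U(1) by blast
  define a' where "a' = k \<otimes> inv a \<otimes> inv k"
  define b' where "b' = l \<otimes> inv b \<otimes> inv l"
  have a': "a' \<in> supported (k ` V)" unfolding a'_def by (rule supported_conj[OF supported_inv[OF a] k VX])
  have b': "b' \<in> supported (l ` V)" unfolding b'_def by (rule supported_conj[OF supported_inv[OF b] l VX])
  note K' = supported_carrier[OF a'] supported_carrier[OF b']
  have "a \<otimes> a' = commutator K a k" "b \<otimes> b' = commutator K b l"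
    using K k l by (simp_all add: a'_def b'_def commutator_def m_assoc)
  then have D: "a \<otimes> a' \<in> derived K (carrier K)" "b \<otimes> b' \<in> derived K (carrier K)"
    using commutator_in_derived K k l by auto
  have S: "a \<otimes> a' \<in> supported U" "b \<otimes> b' \<in> supported U"
    using supported_mono[OF a V(1)] supported_mono[OF a' V(2)] supported_mono[OF b V(1)]
      supported_mono[OF b' V(3)] supported_mult by blast+
  have "b' \<otimes> a = a \<otimes> b'" using V by (intro supported_commute[OF b' a]) blast
  moreover have "a' \<otimes> (b \<otimes> b') = (b \<otimes> b') \<otimes> a'"
  proof (rule supported_commute[OF a'])
    show "b \<otimes> b' \<in> supported (V \<union> l ` V)"
      using supported_mono[OF b, of "V \<union> l ` V"] supported_mono[OF b', of "V \<union> l ` V"] by (intro supported_mult) auto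
    show "k ` V \<inter> (V \<union> l ` V) = {}" using V by blast
  qed
  ultimately have "commutator K a b = commutator K (a \<otimes> a') (b \<otimes> b')"
    using K K' by (simp add: commutator_absorb_left commutator_absorb_right)
  then show ?thesis
    using commutator_of_derived_in_normal[OF N conj \<alpha> U D(1) S(1) D(2) S(2)] by simp
qed

text \<open>
  Three disjoint clopen subsets of a set \<open>U\<close> that is moved off itself by \<open>\<alpha>\<close> receive \<open>Z\<close> and its two copies.
  Moving \<open>Z\<close> there must be done by an element of the derived subgroup, since only these normalise \<open>N\<close>;
  the copies may be made by any element of the group.
\<close>

lemma small_commutators:
  assumes N: "subgroup N K"
    and conj: "\<And>n d. n \<in> N \<Longrightarrow> d \<in> derived K (carrier K) \<Longrightarrow> d \<otimes> n \<otimes> inv d \<in> N"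
    and \<alpha>: "\<alpha> \<in> N" "\<alpha> \<noteq> \<one>"
  obtains \<epsilon> :: real where "\<epsilon> > 0"
    "\<And>Z a b. Z \<in> C \<Longrightarrow> Z \<noteq> X \<Longrightarrow> (\<And>m. m \<in> M \<Longrightarrow> m Z < \<epsilon>) \<Longrightarrow> a \<in> supported Z \<Longrightarrow> b \<in> supported Z
      \<Longrightarrow> commutator K a b \<in> N"
proof -
  have D: "subgroup (derived K (carrier K)) K" by (rule derived_is_subgroup) simp
  note \<alpha>K = subgroup.mem_carrier[OF N \<alpha>(1)]
  have "\<exists>x \<in> X. \<alpha> x \<noteq> x"
  proof (rule ccontr)
    assume "\<not> (\<exists>x \<in> X. \<alpha> x \<noteq> x)"
    then have "\<alpha> = \<one>" using \<alpha>K by (intro perm_eqI) auto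
    then show False using \<alpha>(2) by simp
  qed
  then obtain x where x: "x \<in> X" "\<alpha> x \<noteq> x" by blast
  obtain A where A: "A \<in> C" "x \<in> A" "\<alpha> x \<notin> A"
    using separated[OF x(1) apply_in[OF \<alpha>K x(1)] x(2)[symmetric]] by blast
  define U where "U = A - (inv \<alpha>) ` A"
  have AX: "A \<subseteq> X" using A clopen_subset by blast
  have UC: "U \<in> C" using A image_clopen[of "inv \<alpha>" A] \<alpha>K by (simp add: U_def)
  have mem: "y \<in> (inv \<alpha>) ` A \<longleftrightarrow> \<alpha> y \<in> A" if "y \<in> X" for y
    using mem_image_iff[of "inv \<alpha>" A y] \<alpha>K AX that by simp
  have "x \<in> U" using A mem[OF x(1)] by (simp add: U_def)
  then have U_ne: "U \<noteq> {}" by blast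
  have UX: "U \<subseteq> X" using UC by (rule clopen_subset)
  have U: "U \<inter> \<alpha> ` U = {}" using mem AX by (auto simp: U_def)
  obtain U1 U' where U1: "U1 \<in> C" "U' \<in> C" "U1 \<noteq> {}" "U' \<noteq> {}" "U1 \<inter> U' = {}" "U1 \<subseteq> U" "U' \<subseteq> U"
    using split_clopen[OF UC U_ne] by metis
  obtain U2 U3 where U2: "U2 \<in> C" "U3 \<in> C" "U2 \<noteq> {}" "U3 \<noteq> {}" "U2 \<inter> U3 = {}" "U2 \<subseteq> U'" "U3 \<subseteq> U'"
    using split_clopen[OF U1(2,4)] by metis
  obtain \<epsilon>1 where \<epsilon>1: "\<epsilon>1 > 0" "\<And>Z. Z \<in> C \<Longrightarrow> Z \<noteq> X \<Longrightarrow> (\<And>m. m \<in> M \<Longrightarrow> m Z < \<epsilon>1)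
      \<Longrightarrow> \<exists>h \<in> derived K (carrier K). h ` Z \<subseteq> U1"
    using derived_move[OF U1(1,3)] by blast
  obtain \<epsilon>2 where \<epsilon>2: "\<epsilon>2 > 0" "\<And>m. m \<in> M \<Longrightarrow> \<epsilon>2 \<le> m U2" using mass_lower_bound[OF U2(1,3)] by blast
  obtain \<epsilon>3 where \<epsilon>3: "\<epsilon>3 > 0" "\<And>m. m \<in> M \<Longrightarrow> \<epsilon>3 \<le> m U3" using mass_lower_bound[OF U2(2,4)] by blast
  define \<epsilon> where "\<epsilon> = min \<epsilon>1 (min \<epsilon>2 \<epsilon>3)"
  have "commutator K a b \<in> N"
    if Z: "Z \<in> C" "Z \<noteq> X" and small: "\<And>m. m \<in> M \<Longrightarrow> m Z < \<epsilon>" and a: "a \<in> supported Z" and b: "b \<in> supported Z"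
    for Z a b
  proof -
    have "m Z < \<epsilon>1" if "m \<in> M" for m using small[OF that] by (simp add: \<epsilon>_def)
    then obtain h where h: "h \<in> derived K (carrier K)" "h ` Z \<subseteq> U1" using \<epsilon>1(2)[OF Z] by blast
    note hK = subgroup.mem_carrier[OF D h(1)]
    have V: "h ` Z \<in> C" using image_clopen hK Z by blast
    have ZX: "Z \<subseteq> X" using Z clopen_subset by blast
    have "m (h ` Z) < m U2" "m (h ` Z) < m U3" if m: "m \<in> M" for m
      using small[OF m] \<epsilon>2(2)[OF m] \<epsilon>3(2)[OF m] mass_image[OF m hK Z(1)] by (simp_all add: \<epsilon>_def)
    moreover have disj: "h ` Z \<inter> U2 = {}" "h ` Z \<inter> U3 = {}" using h(2) U1 U2 by blast+
    ultimately obtain k l where k: "k \<in> carrier K" "k ` (h ` Z) \<subseteq> U2"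
      and l: "l \<in> carrier K" "l ` (h ` Z) \<subseteq> U3"
      using comparison[OF V U2(1) _ U2(3)] comparison[OF V U2(2) _ U2(4)] by metis
    have "commutator K (h \<otimes> a \<otimes> inv h) (h \<otimes> b \<otimes> inv h) \<in> N"
    proof (rule commutator_in_normal[OF N conj \<alpha>(1) UX U k(1) l(1)])
      show "h ` Z \<subseteq> U" "k ` (h ` Z) \<subseteq> U" "l ` (h ` Z) \<subseteq> U"
        using h k l U1 U2 by (metis order_trans)+
      have sub: "B \<inter> B' = {}" if "A \<inter> A' = {}" "B \<subseteq> A" "B' \<subseteq> A'" for A A' B B' :: "'a set"
        using that by blast
      show "h ` Z \<inter> k ` (h ` Z) = {}" by (rule sub[OF disj(1) subset_refl k(2)])
      show "h ` Z \<inter> l ` (h ` Z) = {}" by (rule sub[OF disj(2) subset_refl l(2)])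
      show "k ` (h ` Z) \<inter> l ` (h ` Z) = {}" by (rule sub[OF U2(5) k(2) l(2)])
    qed (use supported_conj a b hK ZX in auto)
    then have "h \<otimes> commutator K a b \<otimes> inv h \<in> N"
      using conj_commutator[of a b h] a b supported_carrier hK by simp
    then have "inv h \<otimes> (h \<otimes> commutator K a b \<otimes> inv h) \<otimes> inv (inv h) \<in> N"
      using conj subgroup.m_inv_closed[OF D h(1)] by blast
    then show ?thesis
      using a b hK supported_carrier commutator_closed[of a b] by (simp add: m_assoc)
  qed
  then show thesis using that[of \<epsilon>] \<epsilon>1(1) \<epsilon>2(1) \<epsilon>3(1) by (simp add: \<epsilon>_def)
qed

lemma derived_subset_of_normal:
  assumes N: "subgroup N K"
    and conj: "\<And>n d. n \<in> N \<Longrightarrow> d \<in> derived K (carrier K) \<Longrightarrow> d \<otimes> n \<otimes> inv d \<in> N"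
    and \<alpha>: "\<alpha> \<in> N" "\<alpha> \<noteq> \<one>"
  shows "derived K (carrier K) \<subseteq> N"
proof -
  obtain \<epsilon> :: real where \<epsilon>: "\<epsilon> > 0" and small: "\<And>Z a b. Z \<in> C \<Longrightarrow> Z \<noteq> X \<Longrightarrow> (\<And>m. m \<in> M \<Longrightarrow> m Z < \<epsilon>) \<Longrightarrow>
      a \<in> supported Z \<Longrightarrow> b \<in> supported Z \<Longrightarrow> commutator K a b \<in> N"
    using small_commutators[OF N conj \<alpha>] by blast
  obtain F where F: "finite F" "F \<subseteq> X" "card F = 5"
    using infinite_arbitrarily_large[OF infinite_X] by metis
  show ?thesis
  proof (rule derived_subset_of_generators[OF N fragments_carrier])
    show "generate K (fragments (\<epsilon> / 4) F) = carrier K" using generate_fragments \<epsilon> F by simp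
    fix a b c assume a: "a \<in> fragments (\<epsilon> / 4) F" and b: "b \<in> fragments (\<epsilon> / 4) F" and c: "c \<in> carrier K"
    obtain A1 A2 where A: "tiny (\<epsilon> / 4) F A1" "tiny (\<epsilon> / 4) F A2" "a \<in> supported (A1 \<union> A2)"
      using a by (auto simp: fragments_def)
    obtain B1 B2 where B: "tiny (\<epsilon> / 4) F B1" "tiny (\<epsilon> / 4) F B2" "b \<in> supported (B1 \<union> B2)"
      using b by (auto simp: fragments_def)
    \<comment> \<open>Four tiny sets meet \<open>F\<close> in at most four of its five points.\<close>
    define Z where "Z = (A1 \<union> A2) \<union> (B1 \<union> B2)"
    have clopen: "A1 \<in> C" "A2 \<in> C" "B1 \<in> C" "B2 \<in> C" using A B by (auto simp: tiny_def)
    then have Z: "Z \<in> C" by (simp add: Z_def)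
    have ZX: "Z \<subseteq> X" using Z by (rule clopen_subset)
    have "card (Z \<inter> F) \<le> 4"
    proof -
      have "Z \<inter> F = (A1 \<inter> F \<union> A2 \<inter> F) \<union> (B1 \<inter> F \<union> B2 \<inter> F)" by (auto simp: Z_def)
      then have "card (Z \<inter> F) \<le> card (A1 \<inter> F) + card (A2 \<inter> F) + (card (B1 \<inter> F) + card (B2 \<inter> F))"
        by (simp only:) (rule order_trans[OF card_Un_le add_mono[OF card_Un_le card_Un_le]])
      then show ?thesis using A B by (simp add: tiny_def)
    qed
    then have "Z \<noteq> X" using F by (auto simp: Int_absorb1)
    have mZ: "m Z < \<epsilon>" if m: "m \<in> M" for m
    proof -
      have "m A1 < \<epsilon> / 4" "m A2 < \<epsilon> / 4" "m B1 < \<epsilon> / 4" "m B2 < \<epsilon> / 4"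
        using A(1,2) B(1,2) m by (auto simp: tiny_def)
      moreover have "m Z \<le> (m A1 + m A2) + (m B1 + m B2)"
        unfolding Z_def using clopen
        by (intro order_trans[OF mass_Un_le add_mono] mass_Un_le m clopen_ops)
      ultimately show ?thesis by linarith
    qed
    have sup: "a \<in> supported Z" "b \<in> supported Z"
      by (rule supported_mono[OF A(3)] supported_mono[OF B(3)]; force simp: Z_def)+
    have "commutator K (c \<otimes> a \<otimes> inv c) (c \<otimes> b \<otimes> inv c) \<in> N"
    proof (rule small[of "c ` Z"])
      show "c ` Z \<in> C" using image_clopen c Z by blast
      show "c ` Z \<noteq> X"
      proof
        assume "c ` Z = X"
        then have "c ` Z = c ` X" using image_carrier c by simp
        then show False using \<open>Z \<noteq> X\<close> ZX apply_inj[OF c] by blast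
      qed
      show "m (c ` Z) < \<epsilon>" if m: "m \<in> M" for m
        using mZ[OF m] mass_image[OF m c Z] by simp
    qed (use supported_conj sup c ZX in auto)
    then show "c \<otimes> commutator K a b \<otimes> inv c \<in> N"
      using conj_commutator[of a b c] sup supported_carrier c by simp
  qed
qed

lemma derived_nontrivial: "derived K (carrier K) \<noteq> {\<one>}"
proof
  assume trivial: "derived K (carrier K) = {\<one>}"
  obtain P Q where PQ: "P \<in> C" "Q \<in> C" "P \<noteq> {}" "Q \<noteq> {}" "P \<inter> Q = {}" "P \<subseteq> X" "Q \<subseteq> X"
    using split_clopen[OF _ nonempty] by (metis clopen_ops(2))
  obtain \<epsilon> where \<epsilon>: "\<epsilon> > 0"
    "\<And>Z. Z \<in> C \<Longrightarrow> Z \<noteq> X \<Longrightarrow> (\<And>m. m \<in> M \<Longrightarrow> m Z < \<epsilon>) \<Longrightarrow> \<exists>h \<in> derived K (carrier K). h ` Z \<subseteq> P"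
    using derived_move[OF PQ(1,3)] by blast
  obtain x where "x \<in> Q" using PQ by blast
  then obtain V where V: "V \<in> C" "x \<in> V" "V \<subseteq> Q" "\<And>m. m \<in> M \<Longrightarrow> m V < \<epsilon>"
    using small_neighbourhood[of x Q \<epsilon> "{}"] PQ \<epsilon> by auto
  then have "V \<noteq> X" using PQ by blast
  then have "\<exists>h \<in> derived K (carrier K). h ` V \<subseteq> P" by (intro \<epsilon>(2) V(1,4))
  then have "\<one> ` V \<subseteq> P" using trivial by simp
  then have "\<one> x \<in> P" using V(2) by blast
  moreover have "x \<in> X" using V(1,2) clopen_subset by blast
  ultimately show False using \<open>x \<in> Q\<close> PQ(5) by auto
qed

theorem is_simple_commutator_subgroup: "is_simple (commutator_subgroup K)"
proof -
  let ?D = "derived K (carrier K)"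
  have D: "subgroup ?D K" by (rule derived_is_subgroup) simp
  have "N = {\<one>} \<or> N = ?D" if "N \<lhd> K\<lparr>carrier := ?D\<rparr>" for N
  proof -
    interpret N: normal N "K\<lparr>carrier := ?D\<rparr>" by (rule that)
    have ND: "N \<subseteq> ?D" using N.subset by simp
    have N: "subgroup N K" using incl_subgroup[OF D N.subgroup_axioms] .
    have conj: "d \<otimes> n \<otimes> inv d \<in> N" if "n \<in> N" "d \<in> ?D" for n d
      using N.inv_op_closed2[of d n] that m_inv_consistent[OF D that(2)] by simp
    show ?thesis
    proof (cases "N = {\<one>}")
      case False
      then obtain \<alpha> where "\<alpha> \<in> N" "\<alpha> \<noteq> \<one>" using subgroup.one_closed[OF N] by blast
      then have "?D \<subseteq> N" using derived_subset_of_normal[OF N conj] by blast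
      then show ?thesis using ND by blast
    qed simp
  qed
  then show ?thesis
    using derived_nontrivial subgroup_imp_group[OF D] by (simp add: is_simple_def commutator_subgroup_def)
qed

end


section \<open>The Cantor set\<close>

text \<open>
  The ternary expansion is a continuous injection of the compact space of bit sequences.  Hence the image of a
  closed set of sequences is compact, and prescribing one bit cuts out a clopen subset of the Cantor set.
\<close>

definition ternary :: "(nat \<Rightarrow> bool) \<Rightarrow> real" where
  "ternary b = (\<Sum>n. 2 * of_bool (b n) / 3 ^ Suc n)"

lemma cantor_set_eq: "cantor_set = range ternary"
  by (simp add: cantor_set_def ternary_def)

lemma sums_majorant: "(\<lambda>n. 2 / 3 ^ Suc n :: real) sums 1"
proof -
  have "(\<lambda>n. (2 / 3) * (1 / 3 :: real) ^ n) sums ((2 / 3) * (1 / (1 - 1 / 3)))"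
    by (intro sums_mult geometric_sums) simp
  then show ?thesis by (simp add: power_one_over field_simps)
qed

lemma ternary_summable: "summable (\<lambda>n. 2 * of_bool (b n) / 3 ^ Suc n :: real)"
  by (rule summable_comparison_test'[OF sums_summable[OF sums_majorant], of 0])
     (auto simp: of_bool_def)

lemma ternary_bounds: "0 \<le> ternary b" "ternary b \<le> 1"
proof -
  show "0 \<le> ternary b" unfolding ternary_def by (intro suminf_nonneg ternary_summable) auto
  have "ternary b \<le> (\<Sum>n. 2 / 3 ^ Suc n)"
    unfolding ternary_def
    by (rule suminf_le[OF _ ternary_summable sums_summable[OF sums_majorant]]) (auto simp: of_bool_def)
  then show "ternary b \<le> 1" using sums_unique[OF sums_majorant] by simp
qed

lemma ternary_shift: "3 * ternary b = 2 * of_bool (b 0) + ternary (\<lambda>n. b (Suc n))"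
proof -
  have "ternary b = 2 * of_bool (b 0) / 3 + (\<Sum>n. 2 * of_bool (b (Suc n)) / 3 ^ Suc (Suc n))"
    using suminf_split_head[OF ternary_summable[of b]] by (simp add: ternary_def)
  also have "(\<Sum>n. 2 * of_bool (b (Suc n)) / 3 ^ Suc (Suc n)) = ternary (\<lambda>n. b (Suc n)) / 3"
    using suminf_divide[OF ternary_summable[of "\<lambda>n. b (Suc n)"], of 3]
    by (simp add: ternary_def field_simps)
  finally show ?thesis by simp
qed

text \<open>The first bit can be read off the recursion, since the tail contributes at most 1.\<close>

lemma ternary_inj: "inj ternary"
proof (rule injI, rule ext)
  fix b b' :: "nat \<Rightarrow> bool" and n
  assume "ternary b = ternary b'"
  then show "b n = b' n"
  proof (induction n arbitrary: b b')
    case 0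
    then show ?case
      using ternary_shift[of b] ternary_shift[of b'] ternary_bounds[of "\<lambda>n. b (Suc n)"]
        ternary_bounds[of "\<lambda>n. b' (Suc n)"] by (cases "b 0"; cases "b' 0") auto
  next
    case (Suc n)
    then have "b 0 = b' 0"
      using ternary_shift[of b] ternary_shift[of b'] ternary_bounds[of "\<lambda>n. b (Suc n)"]
        ternary_bounds[of "\<lambda>n. b' (Suc n)"] by (cases "b 0"; cases "b' 0") auto
    then have "ternary (\<lambda>n. b (Suc n)) = ternary (\<lambda>n. b' (Suc n))"
      using ternary_shift[of b] ternary_shift[of b'] Suc.prems by simp
    then show ?case by (rule Suc.IH)
  qed
qed

lemma ternary_close: "(\<And>i. i < n \<Longrightarrow> b i = b' i) \<Longrightarrow> \<bar>ternary b - ternary b'\<bar> \<le> 1 / 3 ^ n"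
proof (induction n arbitrary: b b')
  case 0
  then show ?case using ternary_bounds[of b] ternary_bounds[of b'] by auto
next
  case (Suc n)
  have IH: "\<bar>ternary (\<lambda>n. b (Suc n)) - ternary (\<lambda>n. b' (Suc n))\<bar> \<le> 1 / 3 ^ n"
    using Suc.prems by (intro Suc.IH) auto
  have "3 * \<bar>ternary b - ternary b'\<bar> = \<bar>ternary (\<lambda>n. b (Suc n)) - ternary (\<lambda>n. b' (Suc n))\<bar>"
    using ternary_shift[of b] ternary_shift[of b'] Suc.prems[of 0] by (simp add: abs_if)
  then have "\<bar>ternary b - ternary b'\<bar> = \<bar>ternary (\<lambda>n. b (Suc n)) - ternary (\<lambda>n. b' (Suc n))\<bar> / 3"
    by simp
  also have "\<dots> \<le> (1 / 3 ^ n) / 3" by (rule divide_right_mono[OF IH]) simp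
  finally show ?case by simp
qed

lemma ternary_continuous: "continuous_on UNIV ternary"
proof -
  have "uniform_limit UNIV (\<lambda>n b. \<Sum>i<n. 2 * of_bool (b i) / 3 ^ Suc i)
      (\<lambda>b. \<Sum>i. 2 * of_bool (b i) / 3 ^ Suc i :: real) sequentially"
    by (rule Weierstrass_m_test[OF _ sums_summable[OF sums_majorant]]) (auto simp: of_bool_def)
  moreover have "continuous_on UNIV (\<lambda>b :: nat \<Rightarrow> bool. of_bool (b i) :: real)" for i
  proof -
    have "continuous_on UNIV (of_bool :: bool \<Rightarrow> real)" by simp
    then show ?thesis
      by (rule continuous_on_compose2[OF _ continuous_on_product_coordinates]) simp
  qed
  then have "\<forall>\<^sub>F n in sequentially. continuous_on UNIV
      (\<lambda>b :: nat \<Rightarrow> bool. \<Sum>i<n. 2 * of_bool (b i) / 3 ^ Suc i :: real)"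
    by (intro always_eventually allI continuous_on_sum continuous_on_divide continuous_on_mult
        continuous_on_const) auto
  ultimately show ?thesis
    unfolding ternary_def[abs_def] by (intro uniform_limit_theorem[rotated 1]) auto
qed

lemma compact_bool_sequences: "compact (UNIV :: (nat \<Rightarrow> bool) set)"
proof -
  have "compact_space (euclidean :: bool topology)"
    by (simp add: compact_space_def finite_imp_compact)
  then have "compact_space (product_topology (\<lambda>_. euclidean :: bool topology) (UNIV :: nat set))"
    by (simp add: compact_space_product_topology)
  then have "compact_space (euclidean :: (nat \<Rightarrow> bool) topology)"
    by (simp only: euclidean_product_topology)
  then show ?thesis by (simp add: compact_space_def)
qed

lemma compact_ternary_image: "closed A \<Longrightarrow> compact (ternary ` A)"
  using compact_Int_closed[OF compact_bool_sequences, of A] continuous_on_subset[OF ternary_continuous]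
  by (intro compact_continuous_image) auto

lemma cantor_set_compact: "compact cantor_set"
  unfolding cantor_set_eq by (intro compact_ternary_image) simp

lemma cantor_set_separated:
  assumes "x \<in> cantor_set" "y \<in> cantor_set" "x \<noteq> y"
  obtains A where "closedin (top_of_set cantor_set) A" "openin (top_of_set cantor_set) A" "x \<in> A" "y \<notin> A"
proof -
  obtain b b' where b: "x = ternary b" "y = ternary b'" using assms by (auto simp: cantor_set_eq)
  then have "b \<noteq> b'" using assms by auto
  then obtain n where n: "b n \<noteq> b' n" by (auto simp: fun_eq_iff)
  define D where "D v = ternary ` {c. c n = v}" for v
  have closed: "closedin (top_of_set cantor_set) (D v)" for v
  proof -
    have "closed ((\<lambda>c :: nat \<Rightarrow> bool. c n) -` {v})"
      using continuous_on_product_coordinates[of n] by (intro closed_vimage) auto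
    then have "compact (D v)" unfolding D_def by (intro compact_ternary_image) (simp add: vimage_def)
    then show ?thesis
      by (intro closed_subset compact_imp_closed) (auto simp: D_def cantor_set_eq)
  qed
  have "cantor_set - D (\<not> b n) = D (b n)"
  proof -
    have "range ternary - ternary ` {c. c n = (\<not> b n)} = ternary ` (UNIV - {c. c n = (\<not> b n)})"
      by (rule image_set_diff[OF ternary_inj, symmetric])
    also have "UNIV - {c. c n = (\<not> b n)} = {c. c n = b n}" by auto
    finally show ?thesis unfolding D_def cantor_set_eq .
  qed
  then have "openin (top_of_set cantor_set) (D (b n))"
    using openin_diff[OF openin_topspace closed[of "\<not> b n"]] by simp
  moreover have "x \<in> D (b n)" using b by (auto simp: D_def)
  moreover have "y \<notin> D (b n)" using b n ternary_inj by (auto simp: D_def inj_eq)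
  ultimately show thesis using that closed by blast
qed

lemma cantor_set_perfect:
  assumes "openin (top_of_set cantor_set) A" "x \<in> A"
  obtains y where "y \<in> A" "y \<noteq> x"
proof -
  obtain e where e: "e > 0" "\<And>y. y \<in> cantor_set \<Longrightarrow> dist y x < e \<Longrightarrow> y \<in> A"
    using assms unfolding openin_euclidean_subtopology_iff by blast
  have "x \<in> cantor_set" using openin_subset[OF assms(1)] assms(2) by auto
  then obtain b where b: "x = ternary b" by (auto simp: cantor_set_eq)
  obtain n where n: "(1 / 3) ^ n < e" using real_arch_pow_inv[OF e(1), of "1 / 3"] by auto
  define b' where "b' = b(n := \<not> b n)"
  have "\<bar>ternary b' - ternary b\<bar> \<le> 1 / 3 ^ n" by (rule ternary_close) (simp add: b'_def)
  then have "dist (ternary b') x < e" using n b by (simp add: dist_real_def power_one_over)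
  moreover have "ternary b' \<in> cantor_set" by (simp add: cantor_set_eq)
  moreover have "b' n \<noteq> b n" by (simp add: b'_def)
  then have "ternary b' \<noteq> x" using b ternary_inj by (auto simp: inj_eq)
  ultimately show thesis using that e(2) by blast
qed

lemma cantor_space_properties:
  assumes "cantor_space T"
  shows "compact_space T" "Hausdorff_space T" "topspace T \<noteq> {}"
    and "\<And>x y. x \<in> topspace T \<Longrightarrow> y \<in> topspace T \<Longrightarrow> x \<noteq> y \<Longrightarrow> \<exists>A. clopenin T A \<and> x \<in> A \<and> y \<notin> A"
    and "\<And>A x. openin T A \<Longrightarrow> x \<in> A \<Longrightarrow> \<exists>y \<in> A. y \<noteq> x"
proof -
  have T: "T homeomorphic_space top_of_set cantor_set" using assms by (simp add: cantor_space_def)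
  show "compact_space T"
    using homeomorphic_compact_space[OF T] cantor_set_compact by (simp add: compact_space_subtopology)
  show "Hausdorff_space T"
    using homeomorphic_Hausdorff_space[OF T] by (simp add: Hausdorff_space_subtopology)
  obtain h k where hk: "homeomorphic_maps T (top_of_set cantor_set) h k"
    using T by (auto simp: homeomorphic_space_def)
  then have h: "continuous_map T (top_of_set cantor_set) h" and k: "continuous_map (top_of_set cantor_set) T k"
    and kh: "\<And>x. x \<in> topspace T \<Longrightarrow> k (h x) = x" and hk: "\<And>y. y \<in> cantor_set \<Longrightarrow> h (k y) = y"
    by (auto simp: homeomorphic_maps_def)
  have h_in: "h x \<in> cantor_set" if "x \<in> topspace T" for x
    using continuous_map_image_subset_topspace[OF h] that by auto
  have k_in: "k y \<in> topspace T" if "y \<in> cantor_set" for y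
    using continuous_map_image_subset_topspace[OF k] that by auto
  have "ternary (\<lambda>_. True) \<in> cantor_set" by (simp add: cantor_set_eq)
  then show "topspace T \<noteq> {}" using k_in by blast
  show "\<exists>A. clopenin T A \<and> x \<in> A \<and> y \<notin> A" if x: "x \<in> topspace T" and y: "y \<in> topspace T" and "x \<noteq> y" for x y
  proof -
    have "h x \<noteq> h y" using kh x y \<open>x \<noteq> y\<close> by metis
    then obtain A where A: "closedin (top_of_set cantor_set) A" "openin (top_of_set cantor_set) A" "h x \<in> A" "h y \<notin> A"
      using cantor_set_separated[OF h_in[OF x] h_in[OF y]] by blast
    have "clopenin T {x \<in> topspace T. h x \<in> A}"
      using openin_continuous_map_preimage[OF h A(2)] closedin_continuous_map_preimage[OF h A(1)]
      by (simp add: clopenin_def)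
    then show ?thesis using A x by blast
  qed
  show "\<exists>y \<in> A. y \<noteq> x" if A: "openin T A" "x \<in> A" for A x
  proof -
    let ?B = "{y \<in> topspace (top_of_set cantor_set). k y \<in> A}"
    have x: "x \<in> topspace T" using A openin_subset by blast
    have "openin (top_of_set cantor_set) ?B" by (rule openin_continuous_map_preimage[OF k A(1)])
    moreover have "h x \<in> ?B" using h_in[OF x] kh[OF x] A(2) by simp
    ultimately obtain y where y: "y \<in> ?B" "y \<noteq> h x" by (rule cantor_set_perfect)
    then have "k y \<noteq> x" using hk by auto
    then show ?thesis using y by blast
  qed
qed

section \<open>Continuity and Borel sets\<close>

lemma continuous_map_locally:
  assumes "\<And>x. x \<in> topspace X \<Longrightarrow> \<exists>U. openin X U \<and> x \<in> U \<and> continuous_map (subtopology X U) Y f"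
  shows "continuous_map X Y f"
  unfolding continuous_map_eq_topcontinuous_at
proof
  fix x assume "x \<in> topspace X"
  then obtain U where U: "openin X U" "x \<in> U" "continuous_map (subtopology X U) Y f"
    using assms by blast
  have into: "f \<in> topspace X \<rightarrow> topspace Y"
  proof
    fix z assume "z \<in> topspace X"
    then obtain W where W: "openin X W" "z \<in> W" "continuous_map (subtopology X W) Y f"
      using assms by blast
    then have "z \<in> topspace (subtopology X W)" using \<open>z \<in> topspace X\<close> by simp
    then show "f z \<in> topspace Y" using continuous_map_image_subset_topspace[OF W(3)] by blast
  qed
  show "topcontinuous_at X Y f x"
    unfolding topcontinuous_at_def
  proof (intro conjI allI impI)
    fix V assume V: "openin Y V \<and> f x \<in> V"
    let ?W = "{z \<in> topspace (subtopology X U). f z \<in> V}"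
    have "openin (subtopology X U) ?W" using openin_continuous_map_preimage[OF U(3)] V by blast
    then have "openin X ?W" using openin_trans_full U(1) by blast
    moreover have "x \<in> ?W" using U V \<open>x \<in> topspace X\<close> by auto
    ultimately show "\<exists>U. openin X U \<and> x \<in> U \<and> (\<forall>y \<in> U. f y \<in> V)" by blast
  qed (use \<open>x \<in> topspace X\<close> into in auto)
qed

lemma local_homeomorphism_imp_continuous:
  assumes "local_homeomorphism X Y f"
  shows "continuous_map X Y f"
proof (rule continuous_map_locally)
  fix x assume "x \<in> topspace X"
  then obtain U where U: "openin X U" "x \<in> U"
    "homeomorphic_map (subtopology X U) (subtopology Y (f ` U)) f"
    using assms unfolding local_homeomorphism_def by blast
  then have "continuous_map (subtopology X U) (subtopology Y (f ` U)) f"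
    by (simp add: homeomorphic_imp_continuous_map)
  then have "continuous_map (subtopology X U) Y f" by (rule continuous_map_into_fulltopology)
  then show "\<exists>U. openin X U \<and> x \<in> U \<and> continuous_map (subtopology X U) Y f" using U by blast
qed

lemma local_homeomorphism_imp_open:
  assumes "local_homeomorphism X Y f" "openin X W"
  shows "openin Y (f ` W)"
proof (subst openin_subopen, intro ballI)
  fix y assume "y \<in> f ` W"
  then obtain x where x: "x \<in> W" "y = f x" by blast
  then have "x \<in> topspace X" using assms(2) openin_subset by blast
  then obtain U where U: "openin X U" "x \<in> U" "openin Y (f ` U)"
    "homeomorphic_map (subtopology X U) (subtopology Y (f ` U)) f"
    using assms unfolding local_homeomorphism_def by blast
  have "openin (subtopology X U) (U \<inter> W)"
    using assms(2) by (rule openin_subtopology_Int2)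
  then have "openin (subtopology Y (f ` U)) (f ` (U \<inter> W))"
    using homeomorphic_imp_open_map[OF U(4)] by (simp add: open_map_def)
  then have "openin Y (f ` (U \<inter> W))" using openin_trans_full U(3) by blast
  then show "\<exists>S. openin Y S \<and> y \<in> S \<and> S \<subseteq> f ` W" using x U by blast
qed

lemma continuous_inv_into_compact:
  assumes f: "continuous_map X Y f" and U: "compactin X U" and Y: "Hausdorff_space Y" and inj: "inj_on f U"
  shows "continuous_map (subtopology Y (f ` U)) X (inv_into U f)"
proof -
  have UX: "U \<subseteq> topspace X" using compactin_subset_topspace[OF U] .
  have top: "topspace (subtopology X U) = U" using UX by auto
  have top': "topspace (subtopology Y (f ` U)) = f ` U"
    using continuous_map_image_subset_topspace[OF f] UX by auto
  have "homeomorphic_map (subtopology X U) (subtopology Y (f ` U)) f"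
  proof (rule continuous_imp_homeomorphic_map)
    show "continuous_map (subtopology X U) (subtopology Y (f ` U)) f"
      using f by (auto simp: continuous_map_in_subtopology continuous_map_from_subtopology)
    show "compact_space (subtopology X U)" using U by (simp add: compactin_subspace)
    show "Hausdorff_space (subtopology Y (f ` U))" using Y by (rule Hausdorff_space_subtopology)
  qed (use top top' inj in auto)
  then obtain g where g: "homeomorphic_maps (subtopology X U) (subtopology Y (f ` U)) f g"
    by (auto simp: homeomorphic_map_maps)
  have "continuous_map (subtopology Y (f ` U)) X g"
    using g by (auto simp: homeomorphic_maps_def intro: continuous_map_into_fulltopology)
  then show ?thesis
  proof (rule continuous_map_eq)
    fix y assume "y \<in> topspace (subtopology Y (f ` U))"
    then obtain x where x: "x \<in> U" "y = f x" using top' by auto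
    then have "g y = x" using g top by (auto simp: homeomorphic_maps_def)
    then show "g y = inv_into U f y" using x inj by simp
  qed
qed

lemma sigma_algebra_borel_sets: "sigma_algebra (topspace X) (borel_sets X)"
  unfolding borel_sets_def by (rule sigma_algebra_sigma_sets) (auto dest: openin_subset)

lemma open_in_borel_sets: "openin X U \<Longrightarrow> U \<in> borel_sets X"
  by (simp add: borel_sets_def sigma_sets.Basic)

lemma continuous_borel_preimage:
  assumes f: "continuous_map X Y f" and E: "E \<in> borel_sets Y"
  shows "{x \<in> topspace X. f x \<in> E} \<in> borel_sets X"
proof -
  interpret sigma_algebra "topspace X" "borel_sets X" by (rule sigma_algebra_borel_sets)
  show ?thesis using E unfolding borel_sets_def[of Y]
  proof (induction rule: sigma_sets.induct)
    case (Basic a)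
    then have "openin Y a" by simp
    then show ?case by (intro open_in_borel_sets openin_continuous_map_preimage[OF f])
  next
    case Empty then show ?case by simp
  next
    case (Compl a)
    have "{x \<in> topspace X. f x \<in> topspace Y - a} = topspace X - {x \<in> topspace X. f x \<in> a}"
      using continuous_map_image_subset_topspace[OF f] by auto
    then show ?case using compl_sets[OF Compl.IH] by simp
  next
    case (Union a)
    have "{x \<in> topspace X. f x \<in> (\<Union>i. a i)} = (\<Union>i::nat. {x \<in> topspace X. f x \<in> a i})" by auto
    moreover have "(\<Union>i::nat. {x \<in> topspace X. f x \<in> a i}) \<in> borel_sets X"
      by (rule countable_nat_UN) (use Union.IH in blast)
    ultimately show ?case by simp
  qed
qed


section \<open>The full group of a groupoid\<close>

locale cantor_groupoid = etale_groupoid G for G :: "'g top_groupoid" +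
  assumes second_countable_arrows: "second_countable (arrows G)"
    and cantor_units: "cantor_space (unit_space G)"
begin

lemmas compact_units = cantor_space_properties(1)[OF cantor_units]
  and Hausdorff_units = cantor_space_properties(2)[OF cantor_units]
  and nonempty_units = cantor_space_properties(3)[OF cantor_units]
  and separated_units = cantor_space_properties(4)[OF cantor_units]
  and perfect_units = cantor_space_properties(5)[OF cantor_units]

lemma units_subset: "units G \<subseteq> topspace (arrows G)"
  using src_closed by (auto simp: units_def)

lemma topspace_units [simp]: "topspace (unit_space G) = units G"
  using units_subset by (auto simp: unit_space_def)

lemmas continuous_src = local_homeomorphism_imp_continuous[OF src_local_homeomorphism]
  and continuous_rng = local_homeomorphism_imp_continuous[OF rng_local_homeomorphism]
  and open_src = local_homeomorphism_imp_open[OF src_local_homeomorphism]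
  and open_rng = local_homeomorphism_imp_open[OF rng_local_homeomorphism]

lemma bisection_subset: "bisection G U \<Longrightarrow> V \<subseteq> U \<Longrightarrow> bisection G V"
  unfolding bisection_def by (meson inj_on_subset subset_trans)

lemma open_bisection_through:
  assumes "g \<in> topspace (arrows G)"
  obtains B where "openin (arrows G) B" "g \<in> B" "bisection G B"
proof -
  obtain U where U: "openin (arrows G) U" "g \<in> U"
    "homeomorphic_map (subtopology (arrows G) U) (subtopology (unit_space G) (src G ` U)) (src G)"
    using src_local_homeomorphism assms unfolding local_homeomorphism_def by blast
  obtain V where V: "openin (arrows G) V" "g \<in> V"
    "homeomorphic_map (subtopology (arrows G) V) (subtopology (unit_space G) (rng G ` V)) (rng G)"
    using rng_local_homeomorphism assms unfolding local_homeomorphism_def by blast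
  have "U \<subseteq> topspace (arrows G)" "V \<subseteq> topspace (arrows G)" using U V openin_subset by blast+
  then have "inj_on (src G) U" "inj_on (rng G) V"
    using homeomorphic_imp_injective_map[OF U(3)] homeomorphic_imp_injective_map[OF V(3)]
    by (auto simp: Int_absorb1)
  then have "bisection G (U \<inter> V)"
    using \<open>U \<subseteq> topspace (arrows G)\<close> by (auto simp: bisection_def inj_on_def)
  then show thesis using that[of "U \<inter> V"] U V by auto
qed

text \<open>Continuity of the inverse is automatic, the unit space being compact and Hausdorff.\<close>

lemma full_group_iff:
  "\<alpha> \<in> carrier (full_group G) \<longleftrightarrow> \<alpha> \<in> Bij (units G) \<and> continuous_map (unit_space G) (unit_space G) \<alpha> \<and>
    (\<forall>x \<in> units G. \<exists>g \<in> topspace (arrows G). src G g = x \<and> rng G g = \<alpha> x)"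
proof -
  have "homeomorphic_map (unit_space G) (unit_space G) \<alpha>"
    if "\<alpha> \<in> Bij (units G)" "continuous_map (unit_space G) (unit_space G) \<alpha>"
    using that compact_units Hausdorff_units
    by (intro continuous_imp_homeomorphic_map) (auto simp: Bij_def bij_betw_def)
  then show ?thesis
    by (auto simp: full_group_def homeomorphic_imp_continuous_map)
qed

text \<open>Composition is witnessed by products of arrows, inversion by inverse arrows, the identity by units.\<close>

lemma subgroup_full_group: "subgroup (carrier (full_group G)) (BijGroup (units G))"
proof
  show "carrier (full_group G) \<subseteq> carrier (BijGroup (units G))"
    by (auto simp: full_group_iff BijGroup_def)
next
  fix a b assume a: "a \<in> carrier (full_group G)" and b: "b \<in> carrier (full_group G)"
  then have Bij: "a \<in> Bij (units G)" "b \<in> Bij (units G)" by (auto simp: full_group_iff)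
  have b_in: "b x \<in> units G" if "x \<in> units G" for x
    using Bij(2) that by (auto simp: Bij_def bij_betw_def)
  have "compose (units G) a b \<in> carrier (full_group G)"
    unfolding full_group_iff
  proof (intro conjI ballI)
    show "compose (units G) a b \<in> Bij (units G)" using Bij by (rule compose_Bij)
    show "continuous_map (unit_space G) (unit_space G) (compose (units G) a b)"
      by (rule continuous_map_eq[OF continuous_map_compose[of _ "unit_space G" b _ a]])
        (use a b in \<open>auto simp: full_group_iff compose_def\<close>)
    fix x assume x: "x \<in> units G"
    obtain h where h: "h \<in> topspace (arrows G)" "src G h = x" "rng G h = b x"
      using b x by (auto simp: full_group_iff)
    obtain g where g: "g \<in> topspace (arrows G)" "src G g = b x" "rng G g = a (b x)"
      using a b_in[OF x] by (auto simp: full_group_iff)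
    have gh: "(g, h) \<in> composable G" using g h by (simp add: composable_def)
    show "\<exists>g \<in> topspace (arrows G). src G g = x \<and> rng G g = compose (units G) a b x"
      using gmult_closed[OF gh] src_gmult[OF gh] rng_gmult[OF gh] g h x
      by (intro bexI[of _ "gmult G g h"]) (auto simp: compose_def)
  qed
  then show "a \<otimes>\<^bsub>BijGroup (units G)\<^esub> b \<in> carrier (full_group G)"
    using Bij by (simp add: BijGroup_def)
next
  have "(\<lambda>x \<in> units G. x) \<in> carrier (full_group G)"
    unfolding full_group_iff
  proof (intro conjI ballI)
    show "continuous_map (unit_space G) (unit_space G) (\<lambda>x \<in> units G. x)"
      by (rule continuous_map_eq[OF continuous_map_id]) simp
    show "\<exists>g \<in> topspace (arrows G). src G g = x \<and> rng G g = (\<lambda>x \<in> units G. x) x" if "x \<in> units G" for x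
      using that units_subset src_unit rng_unit by (intro bexI[of _ x]) auto
  qed (rule id_Bij)
  then show "\<one>\<^bsub>BijGroup (units G)\<^esub> \<in> carrier (full_group G)" by (simp add: BijGroup_def)
next
  fix a assume a: "a \<in> carrier (full_group G)"
  then have Bij: "a \<in> Bij (units G)" by (auto simp: full_group_iff)
  let ?b = "\<lambda>x \<in> units G. inv_into (units G) a x"
  have aX: "a ` units G = units G" "inj_on a (units G)" using Bij by (auto simp: Bij_def bij_betw_def)
  have "?b \<in> carrier (full_group G)"
    unfolding full_group_iff
  proof (intro conjI ballI)
    show "?b \<in> Bij (units G)" using Bij by (rule restrict_inv_into_Bij)
    have "continuous_map (subtopology (unit_space G) (a ` units G)) (unit_space G) (inv_into (units G) a)"
      using a compact_units Hausdorff_units aX(2)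
      by (intro continuous_inv_into_compact) (auto simp: full_group_iff compact_space_def)
    then have "continuous_map (unit_space G) (unit_space G) (inv_into (units G) a)"
      using aX(1) by (metis topspace_units subtopology_topspace)
    then show "continuous_map (unit_space G) (unit_space G) ?b"
      by (rule continuous_map_eq) simp
    fix y assume y: "y \<in> units G"
    then obtain x where x: "x \<in> units G" "y = a x" using aX by blast
    then obtain g where g: "g \<in> topspace (arrows G)" "src G g = x" "rng G g = a x"
      using a by (auto simp: full_group_iff)
    then show "\<exists>g \<in> topspace (arrows G). src G g = y \<and> rng G g = ?b y"
      using x y aX(2) ginv_closed[OF g(1)] src_ginv[OF g(1)] rng_ginv[OF g(1)]
      by (intro bexI[of _ "ginv G g"]) auto
  qed
  then show "inv\<^bsub>BijGroup (units G)\<^esub> a \<in> carrier (full_group G)"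
    using inv_BijGroup[OF Bij] by simp
qed

lemma full_group_eq: "full_group G = (BijGroup (units G))\<lparr>carrier := carrier (full_group G)\<rparr>"
  by (simp add: full_group_def)

sublocale full: permutation_group "full_group G" "units G"
proof -
  have "group (full_group G)"
    by (subst full_group_eq) (rule subgroup.subgroup_is_group[OF subgroup_full_group group_BijGroup])
  moreover have "permutation_group_axioms (full_group G) (units G)"
  proof
    show "carrier (full_group G) \<subseteq> Bij (units G)" by (auto simp: full_group_iff)
    fix f g x assume "f \<in> carrier (full_group G)" "g \<in> carrier (full_group G)" "x \<in> units G"
    then show "(f \<otimes>\<^bsub>full_group G\<^esub> g) x = f (g x)"
      by (subst full_group_eq) (auto simp: BijGroup_def full_group_iff compose_def)
  qed
  ultimately show "permutation_group (full_group G) (units G)" by (rule permutation_group.intro)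
qed

lemma full_group_continuous:
  "\<alpha> \<in> carrier (full_group G) \<Longrightarrow> continuous_map (unit_space G) (unit_space G) \<alpha>"
  by (simp add: full_group_iff)

lemma full_group_image_eq_preimage:
  assumes \<alpha>: "\<alpha> \<in> carrier (full_group G)" and A: "A \<subseteq> units G"
  shows "\<alpha> ` A = {y \<in> units G. (inv\<^bsub>full_group G\<^esub> \<alpha>) y \<in> A}"
proof -
  have "\<alpha> ` A \<subseteq> units G" by (rule full.image_subset[OF \<alpha> A])
  then show ?thesis using full.mem_image_iff[OF \<alpha> A] by blast
qed

lemma full_group_image_clopen:
  assumes \<alpha>: "\<alpha> \<in> carrier (full_group G)" and A: "clopenin (unit_space G) A"
  shows "clopenin (unit_space G) (\<alpha> ` A)"
proof -
  have "A \<subseteq> units G" using A openin_subset[of "unit_space G" A] by (simp add: clopenin_def)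
  then have eq: "\<alpha> ` A = {y \<in> topspace (unit_space G). (inv\<^bsub>full_group G\<^esub> \<alpha>) y \<in> A}"
    using full_group_image_eq_preimage[OF \<alpha>] by simp
  have "continuous_map (unit_space G) (unit_space G) (inv\<^bsub>full_group G\<^esub> \<alpha>)"
    using \<alpha> by (intro full_group_continuous full.inv_closed)
  then show ?thesis
    using A openin_continuous_map_preimage closedin_continuous_map_preimage
    unfolding clopenin_def eq by blast
qed

lemma full_group_glue:
  assumes f: "f \<in> Bij (units G)"
    and loc: "\<And>x. x \<in> units G \<Longrightarrow> \<exists>A. clopenin (unit_space G) A \<and> x \<in> A \<and>
      (\<exists>g \<in> carrier (full_group G). \<forall>y \<in> A. f y = g y)"
  shows "f \<in> carrier (full_group G)"
  unfolding full_group_iff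
proof (intro conjI ballI)
  show "f \<in> Bij (units G)" by (rule f)
  show "continuous_map (unit_space G) (unit_space G) f"
  proof (rule continuous_map_locally)
    fix x assume "x \<in> topspace (unit_space G)"
    then obtain A g where A: "clopenin (unit_space G) A" "x \<in> A" "g \<in> carrier (full_group G)" "\<forall>y \<in> A. f y = g y"
      using loc[of x] by auto
    have "continuous_map (subtopology (unit_space G) A) (unit_space G) f"
      by (rule continuous_map_eq[OF continuous_map_from_subtopology[OF full_group_continuous[OF A(3)]]])
        (use A(4) in auto)
    then show "\<exists>U. openin (unit_space G) U \<and> x \<in> U \<and> continuous_map (subtopology (unit_space G) U) (unit_space G) f"
      using A by (auto simp: clopenin_def)
  qed
  fix x assume x: "x \<in> units G"
  then obtain g where "g \<in> carrier (full_group G)" "f x = g x" using loc[OF x] by blast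
  then show "\<exists>g \<in> topspace (arrows G). src G g = x \<and> rng G g = f x"
    using x by (auto simp: full_group_iff)
qed


subsection \<open>Invariant measures\<close>

lemma invariant_measureD:
  assumes "\<mu> \<in> invariant_measures G"
  shows "prob_space \<mu>" "space \<mu> = units G" "sets \<mu> = borel_sets (unit_space G)"
    and "\<And>U E. openin (arrows G) U \<Longrightarrow> bisection G U \<Longrightarrow> E \<in> borel_sets (arrows G) \<Longrightarrow> E \<subseteq> U
      \<Longrightarrow> emeasure \<mu> (src G ` E) = emeasure \<mu> (rng G ` E)"
  using assms by (auto simp: invariant_measures_def regular_borel_probability_def)

lemma clopen_sets:
  assumes "\<mu> \<in> invariant_measures G" "clopenin (unit_space G) A"
  shows "A \<in> sets \<mu>"
  using assms by (simp add: invariant_measureD(3) open_in_borel_sets clopenin_def)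

lemma countable_bisection_cover:
  obtains B :: "nat \<Rightarrow> 'g set" where "\<And>i. openin (arrows G) (B i)" "\<And>i. bisection G (B i)"
    "topspace (arrows G) = (\<Union>i. B i)"
proof -
  obtain \<B> where "countable \<B> \<and> (\<forall>V \<in> \<B>. openin (arrows G) V) \<and>
      (\<forall>U x. openin (arrows G) U \<and> x \<in> U \<longrightarrow> (\<exists>V \<in> \<B>. x \<in> V \<and> V \<subseteq> U))"
    using second_countable_arrows unfolding second_countable_def by (rule exE)
  then have \<B>: "countable \<B>" "\<And>V. V \<in> \<B> \<Longrightarrow> openin (arrows G) V"
    "\<And>U x. openin (arrows G) U \<Longrightarrow> x \<in> U \<Longrightarrow> \<exists>V \<in> \<B>. x \<in> V \<and> V \<subseteq> U"
    by simp_all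
  define \<B>' where "\<B>' = insert {} {V \<in> \<B>. bisection G V}"
  have count: "countable \<B>'" using \<B>(1) by (auto simp: \<B>'_def)
  have range: "range (from_nat_into \<B>') = \<B>'"
    by (rule range_from_nat_into[OF _ count]) (simp add: \<B>'_def)
  have open_bi: "openin (arrows G) V" "bisection G V" if "V \<in> \<B>'" for V
    using that \<B>(2) by (auto simp: \<B>'_def bisection_def)
  have "topspace (arrows G) \<subseteq> \<Union> \<B>'"
  proof
    fix g assume "g \<in> topspace (arrows G)"
    then obtain U where U: "openin (arrows G) U" "g \<in> U" "bisection G U" by (rule open_bisection_through)
    then obtain V where "V \<in> \<B>" "g \<in> V" "V \<subseteq> U" using \<B>(3) by blast
    moreover have "bisection G V" using bisection_subset[OF U(3) \<open>V \<subseteq> U\<close>] .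
    ultimately show "g \<in> \<Union> \<B>'" by (auto simp: \<B>'_def)
  qed
  moreover have "\<Union> \<B>' \<subseteq> topspace (arrows G)" using open_bi(1) openin_subset by blast
  ultimately have "topspace (arrows G) = (\<Union>i. from_nat_into \<B>' i)" using range by auto
  moreover have "from_nat_into \<B>' i \<in> \<B>'" for i using range by auto
  ultimately show thesis using that[of "from_nat_into \<B>'"] open_bi by blast
qed

text \<open>
  For a countable cover by open bisections \<open>B i\<close>, the points \<open>x\<close> of \<open>A\<close> at which some arrow in \<open>B i\<close> leads
  from \<open>x\<close> to \<open>\<alpha> x\<close> form a Borel set \<open>E i\<close>.  On disjoint Borel pieces of the \<open>E i\<close>, the map \<open>\<alpha>\<close> is the
  range map of a Borel subset of a bisection, so it preserves the measure there, and the pieces add up.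
\<close>

lemma full_group_preserves_measure:
  assumes \<mu>: "\<mu> \<in> invariant_measures G" and \<alpha>: "\<alpha> \<in> carrier (full_group G)"
    and A: "clopenin (unit_space G) A"
  shows "emeasure \<mu> (\<alpha> ` A) = emeasure \<mu> A"
proof -
  note \<mu>_sets = invariant_measureD(3)[OF \<mu>]
  interpret B: sigma_algebra "units G" "borel_sets (unit_space G)"
    using sigma_algebra_borel_sets[of "unit_space G"] by simp
  interpret A: sigma_algebra "topspace (arrows G)" "borel_sets (arrows G)"
    by (rule sigma_algebra_borel_sets)
  obtain B :: "nat \<Rightarrow> 'g set" where B: "\<And>i. openin (arrows G) (B i)" "\<And>i. bisection G (B i)"
    "topspace (arrows G) = (\<Union>i. B i)" using countable_bisection_cover by blast
  have B_sub: "B i \<subseteq> topspace (arrows G)" for i using B(1) openin_subset by blast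
  have AX: "A \<subseteq> units G" using A openin_subset[of "unit_space G" A] by (simp add: clopenin_def)
  define R where "R = {g \<in> topspace (arrows G). src G g \<in> A} \<inter> {g \<in> topspace (arrows G). rng G g = \<alpha> (src G g)}"
  have "closedin (arrows G) R"
    unfolding R_def
  proof (rule closedin_Int)
    show "closedin (arrows G) {g \<in> topspace (arrows G). src G g \<in> A}"
      using closedin_continuous_map_preimage[OF continuous_src] A by (simp add: clopenin_def)
    show "closedin (arrows G) {g \<in> topspace (arrows G). rng G g = \<alpha> (src G g)}"
      using closedin_continuous_maps_eq[OF Hausdorff_units continuous_rng
          continuous_map_compose[OF continuous_src full_group_continuous[OF \<alpha>]]] by simp
  qed
  then have open_diff: "openin (arrows G) (B i - R)" for i using B(1) by (simp add: openin_diff)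
  define E where "E i = src G ` (B i \<inter> R)" for i
  have E_Borel: "E i \<in> borel_sets (unit_space G)" for i
  proof -
    \<comment> \<open>As \<open>B i\<close> is a bisection and the source map is open, \<open>E i\<close> is a difference of open sets.\<close>
    have "src G ` (B i) - src G ` (B i - R) = E i"
      using B(2)[of i] unfolding E_def bisection_def inj_on_def by blast
    moreover have "src G ` (B i) \<in> borel_sets (unit_space G)" "src G ` (B i - R) \<in> borel_sets (unit_space G)"
      using open_src[OF B(1)] open_src[OF open_diff] open_in_borel_sets by blast+
    ultimately show ?thesis using B.Diff by metis
  qed
  have E_cover: "(\<Union>i. E i) = A"
  proof
    show "(\<Union>i. E i) \<subseteq> A" by (auto simp: E_def R_def)
    show "A \<subseteq> (\<Union>i. E i)"
    proof
      fix x assume x: "x \<in> A"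
      then obtain g where g: "g \<in> topspace (arrows G)" "src G g = x" "rng G g = \<alpha> x"
        using \<alpha> AX by (auto simp: full_group_iff)
      then obtain i where "g \<in> B i" using B(3) by auto
      then show "x \<in> (\<Union>i. E i)" using g x by (auto simp: E_def R_def)
    qed
  qed
  define D where "D = disjointed E"
  have D_sub: "D i \<subseteq> E i" for i by (simp add: D_def disjointed_subset)
  have D_Borel: "D i \<in> borel_sets (unit_space G)" for i
    using B.range_disjointed_sets[of E] E_Borel by (auto simp: D_def)
  have D_disj: "disjoint_family D" by (simp add: D_def disjoint_family_disjointed)
  have D_cover: "(\<Union>i. D i) = A" using UN_disjointed_eq[of E] E_cover by (simp add: D_def)
  have DX: "D i \<subseteq> units G" for i using D_cover AX by blast
  define P where "P i = (B i \<inter> R) \<inter> {g \<in> topspace (arrows G). src G g \<in> D i}" for i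
  have "closedin (arrows G) R" by fact
  then have "topspace (arrows G) - (topspace (arrows G) - R) = R" "topspace (arrows G) - R \<in> borel_sets (arrows G)"
    using closedin_subset by (auto intro: open_in_borel_sets)
  then have "R \<in> borel_sets (arrows G)" using A.compl_sets by metis
  then have P_Borel: "P i \<in> borel_sets (arrows G)" for i
    unfolding P_def using open_in_borel_sets[OF B(1)] continuous_borel_preimage[OF continuous_src D_Borel]
    by (intro A.Int) auto
  have src_P: "src G ` P i = D i" for i
    using D_sub[of i] B_sub[of i] by (auto simp: P_def E_def)
  have rng_P: "rng G ` P i = \<alpha> ` D i" for i
  proof -
    have "rng G ` P i = (\<lambda>g. \<alpha> (src G g)) ` P i" by (rule image_cong) (auto simp: P_def R_def)
    also have "\<dots> = \<alpha> ` D i" using src_P[of i] by (metis image_image)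
    finally show ?thesis .
  qed
  have eq: "emeasure \<mu> (\<alpha> ` D i) = emeasure \<mu> (D i)" for i
  proof -
    have "P i \<subseteq> B i" by (auto simp: P_def)
    from invariant_measureD(4)[OF \<mu> B(1) B(2) P_Borel this] show ?thesis
      unfolding src_P rng_P by (rule sym)
  qed
  have img_Borel: "\<alpha> ` D i \<in> borel_sets (unit_space G)" for i
    using full_group_image_eq_preimage[OF \<alpha> DX[of i]] D_Borel[of i]
      continuous_borel_preimage[OF full_group_continuous[OF full.inv_closed[OF \<alpha>]], of "D i"] by simp
  have img_disj: "disjoint_family (\<lambda>i. \<alpha> ` D i)"
    unfolding disjoint_family_on_def
  proof (intro ballI impI)
    fix i j :: nat assume "i \<noteq> j"
    then have "D i \<inter> D j = {}" using D_disj by (simp add: disjoint_family_on_def)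
    then show "\<alpha> ` D i \<inter> \<alpha> ` D j = {}" using full.apply_inj[OF \<alpha>] DX[of i] DX[of j] by blast
  qed
  have "emeasure \<mu> (\<alpha> ` A) = emeasure \<mu> (\<Union>i. \<alpha> ` D i)" using D_cover by (simp flip: image_UN)
  also have "\<dots> = (\<Sum>i. emeasure \<mu> (\<alpha> ` D i))"
    using img_Borel img_disj \<mu>_sets by (intro suminf_emeasure[symmetric]) auto
  also have "\<dots> = (\<Sum>i. emeasure \<mu> (D i))" using eq by simp
  also have "\<dots> = emeasure \<mu> (\<Union>i. D i)"
    using D_Borel D_disj \<mu>_sets by (intro suminf_emeasure) auto
  finally show ?thesis using D_cover by simp
qed

lemma clopen_basis:
  assumes S: "openin (unit_space G) S" and x: "x \<in> S"
  obtains V where "clopenin (unit_space G) V" "x \<in> V" "V \<subseteq> S"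
proof -
  have SX: "S \<subseteq> units G" using openin_subset[OF S] by simp
  let ?\<W> = "{W. clopenin (unit_space G) W \<and> x \<notin> W}"
  have "closedin (unit_space G) (units G - S)" using openin_closedin_eq[of "unit_space G" S] S by simp
  then have "compactin (unit_space G) (units G - S)" using compact_units by (simp add: closedin_compact_space)
  moreover have "\<forall>W \<in> ?\<W>. openin (unit_space G) W" by (simp add: clopenin_def)
  moreover have "units G - S \<subseteq> \<Union> ?\<W>"
  proof
    fix y assume y: "y \<in> units G - S"
    then obtain W where "clopenin (unit_space G) W" "y \<in> W" "x \<notin> W"
      using separated_units[of y x] x SX by auto
    then show "y \<in> \<Union> ?\<W>" by blast
  qed
  ultimately obtain \<F> where \<F>: "finite \<F>" "\<F> \<subseteq> ?\<W>" "units G - S \<subseteq> \<Union> \<F>"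
    unfolding compactin_def by meson
  have "openin (unit_space G) (\<Union> \<F>)" "closedin (unit_space G) (\<Union> \<F>)"
    using \<F>(1,2) by (auto simp: clopenin_def intro!: openin_Union closedin_Union)
  then have "clopenin (unit_space G) (units G - \<Union> \<F>)"
    using openin_diff[of "unit_space G" "units G"] closedin_diff[of "unit_space G" "units G"]
      openin_topspace[of "unit_space G"] closedin_topspace[of "unit_space G"] by (simp add: clopenin_def)
  moreover have "x \<in> units G - \<Union> \<F>" using \<F>(2) x SX by blast
  ultimately show thesis using that \<F>(3) by blast
qed

text \<open>
  The orbit of \<open>x\<close> meets \<open>U\<close>, so a bisection maps a neighbourhood of \<open>x\<close> into \<open>U\<close> and preserves all invariant measures.
\<close>

lemma minimal_subordinate:
  assumes min: "minimal_groupoid G" and x: "x \<in> units G" and U: "clopenin (unit_space G) U" "U \<noteq> {}"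
  obtains V where "clopenin (unit_space G) V" "x \<in> V"
    "\<And>\<mu>. \<mu> \<in> invariant_measures G \<Longrightarrow> measure \<mu> V \<le> measure \<mu> U"
proof -
  have U_open: "openin (unit_space G) U" using U by (simp add: clopenin_def)
  have "U \<subseteq> units G" using openin_subset[OF U_open] by simp
  then have "U \<inter> (unit_space G closure_of orbit G x) \<noteq> {}"
    using min x U(2) by (auto simp: minimal_groupoid_def)
  then have "U \<inter> orbit G x \<noteq> {}" using openin_Int_closure_of_eq_empty[OF U_open] by blast
  then obtain g where g: "g \<in> topspace (arrows G)" "src G g = x" "rng G g \<in> U"
    by (auto simp: orbit_def)
  obtain B where B: "openin (arrows G) B" "g \<in> B" "bisection G B"
    using open_bisection_through[OF g(1)] by blast
  define B' where "B' = B \<inter> {g \<in> topspace (arrows G). rng G g \<in> U}"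
  have B'_open: "openin (arrows G) B'"
    unfolding B'_def by (intro openin_Int B(1) openin_continuous_map_preimage[OF continuous_rng U_open])
  have "x \<in> src G ` B'" using B g by (auto simp: B'_def)
  then obtain V where V: "clopenin (unit_space G) V" "x \<in> V" "V \<subseteq> src G ` B'"
    using clopen_basis[OF open_src[OF B'_open]] by blast
  define E where "E = B' \<inter> {g \<in> topspace (arrows G). src G g \<in> V}"
  have "openin (arrows G) E"
    unfolding E_def using V(1)
    by (intro openin_Int B'_open openin_continuous_map_preimage[OF continuous_src]) (simp add: clopenin_def)
  then have E: "E \<in> borel_sets (arrows G)" by (rule open_in_borel_sets)
  have EB: "E \<subseteq> B" by (auto simp: E_def B'_def)
  have src_E: "src G ` E = V" using V(3) by (auto simp: E_def B'_def)
  have rng_E: "rng G ` E \<subseteq> U" by (auto simp: E_def B'_def)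
  have "measure \<mu> V \<le> measure \<mu> U" if \<mu>: "\<mu> \<in> invariant_measures G" for \<mu>
  proof -
    interpret prob_space \<mu> by (rule invariant_measureD(1)[OF \<mu>])
    have "emeasure \<mu> V = emeasure \<mu> (rng G ` E)"
      using invariant_measureD(4)[OF \<mu> B(1,3) E EB] src_E by simp
    also have "\<dots> \<le> emeasure \<mu> U" using rng_E clopen_sets[OF \<mu> U(1)] by (rule emeasure_mono)
    finally show ?thesis by (simp add: emeasure_eq_measure)
  qed
  then show thesis using that V by blast
qed


subsection \<open>Comparison\<close>

text \<open>
  A compact open bisection whose source and range are disjoint acts as an involution that swaps them.
  Compactness makes the two inverse branches continuous.
\<close>

lemma swap_of_bisection:
  assumes U: "compactin (arrows G) U" "openin (arrows G) U" "bisection G U"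
    and disj: "src G ` U \<inter> rng G ` U = {}"
  obtains \<sigma> where "\<sigma> \<in> carrier (full_group G)" "\<And>g. g \<in> U \<Longrightarrow> \<sigma> (src G g) = rng G g"
proof -
  let ?T = "unit_space G" and ?A = "src G ` U" and ?B = "rng G ` U"
  have UX: "U \<subseteq> topspace (arrows G)" and inj: "inj_on (src G) U" "inj_on (rng G) U"
    using U(3) by (auto simp: bisection_def)
  have clopen: "openin ?T ?A" "openin ?T ?B" "closedin ?T ?A" "closedin ?T ?B"
    using open_src[OF U(2)] open_rng[OF U(2)]
      compactin_imp_closedin[OF Hausdorff_units image_compactin[OF U(1) continuous_src]]
      compactin_imp_closedin[OF Hausdorff_units image_compactin[OF U(1) continuous_rng]] by auto
  have sub: "?A \<subseteq> units G" "?B \<subseteq> units G" using clopen openin_subset by force+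
  define s where "s = inv_into U (src G)"
  define t where "t = inv_into U (rng G)"
  have s: "s (src G g) = g" if "g \<in> U" for g using that inj by (simp add: s_def)
  have t: "t (rng G g) = g" if "g \<in> U" for g using that inj by (simp add: t_def)
  define \<sigma> where "\<sigma> = (\<lambda>x \<in> units G. if x \<in> ?A then rng G (s x) else if x \<in> ?B then src G (t x) else x)"
  have \<sigma>_A: "\<sigma> (src G g) = rng G g" if "g \<in> U" for g
    using that s sub by (auto simp: \<sigma>_def)
  have \<sigma>_B: "\<sigma> (rng G g) = src G g" if "g \<in> U" for g
    using that t sub disj by (auto simp: \<sigma>_def)
  have \<sigma>_off: "\<sigma> x = x" if "x \<in> units G" "x \<notin> ?A" "x \<notin> ?B" for x
    using that by (simp add: \<sigma>_def)
  have into: "\<sigma> x \<in> units G" if "x \<in> units G" for x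
  proof -
    consider g where "g \<in> U" "x = src G g" | g where "g \<in> U" "x = rng G g" | "x \<notin> ?A" "x \<notin> ?B" by blast
    then show ?thesis using \<sigma>_A \<sigma>_B \<sigma>_off that sub by cases auto
  qed
  have invol: "\<sigma> (\<sigma> x) = x" if "x \<in> units G" for x
  proof -
    consider g where "g \<in> U" "x = src G g" | g where "g \<in> U" "x = rng G g" | "x \<notin> ?A" "x \<notin> ?B" by blast
    then show ?thesis using \<sigma>_A \<sigma>_B \<sigma>_off that by cases auto
  qed
  have "bij_betw \<sigma> (units G) (units G)"
    by (rule bij_betw_byWitness[where f' = \<sigma>]) (use into invol in auto)
  then have Bij: "\<sigma> \<in> Bij (units G)" by (simp add: Bij_def \<sigma>_def)
  have cont_A: "continuous_map (subtopology ?T ?A) ?T \<sigma>"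
  proof (rule continuous_map_eq)
    show "continuous_map (subtopology ?T ?A) ?T (rng G \<circ> s)"
      unfolding s_def
      by (rule continuous_map_compose[OF continuous_inv_into_compact[OF continuous_src U(1) Hausdorff_units inj(1)] continuous_rng])
  qed (use sub in \<open>auto simp: \<sigma>_A s\<close>)
  have cont_B: "continuous_map (subtopology ?T ?B) ?T \<sigma>"
  proof (rule continuous_map_eq)
    show "continuous_map (subtopology ?T ?B) ?T (src G \<circ> t)"
      unfolding t_def
      by (rule continuous_map_compose[OF continuous_inv_into_compact[OF continuous_rng U(1) Hausdorff_units inj(2)] continuous_src])
  qed (use sub in \<open>auto simp: \<sigma>_B t\<close>)
  have cont_off: "continuous_map (subtopology ?T (units G - ?A - ?B)) ?T \<sigma>"
    by (rule continuous_map_eq[OF continuous_map_from_subtopology[OF continuous_map_id]])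
      (auto simp: \<sigma>_off)
  have open_off: "openin ?T (units G - ?A - ?B)"
    using openin_diff[OF openin_diff[OF openin_topspace clopen(3)] clopen(4)] by simp
  have "continuous_map ?T ?T \<sigma>"
  proof (rule continuous_map_locally)
    fix x assume "x \<in> topspace ?T"
    then consider "x \<in> ?A" | "x \<in> ?B" | "x \<in> units G - ?A - ?B" by force
    then show "\<exists>U. openin ?T U \<and> x \<in> U \<and> continuous_map (subtopology ?T U) ?T \<sigma>"
      using cont_A cont_B cont_off clopen open_off by cases blast+
  qed
  moreover have "\<exists>g \<in> topspace (arrows G). src G g = x \<and> rng G g = \<sigma> x" if x: "x \<in> units G" for x
  proof -
    consider g where "g \<in> U" "x = src G g" | g where "g \<in> U" "x = rng G g" | "x \<notin> ?A" "x \<notin> ?B" by blast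
    then show ?thesis
    proof cases
      case 1
      then show ?thesis using UX \<sigma>_A by (intro bexI[of _ g]) auto
    next
      case 2
      then have "g \<in> topspace (arrows G)" using UX by blast
      then show ?thesis
        using 2 \<sigma>_B by (intro bexI[of _ "ginv G g"]) (auto simp: src_ginv rng_ginv ginv_closed)
    next
      case 3
      then show ?thesis
        using x \<sigma>_off units_subset by (intro bexI[of _ x]) (auto simp: src_unit rng_unit)
    qed
  qed
  ultimately have "\<sigma> \<in> carrier (full_group G)" using Bij by (simp add: full_group_iff)
  then show thesis using that \<sigma>_A by blast
qed

lemma comparison_full_group:
  assumes comp: "has_comparison G" and A: "clopenin (unit_space G) A" and B: "clopenin (unit_space G) B"
    and disj: "A \<inter> B = {}" "B \<noteq> {}"
    and less: "\<And>\<mu>. \<mu> \<in> invariant_measures G \<Longrightarrow> measure \<mu> A < measure \<mu> B"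
  obtains g where "g \<in> carrier (full_group G)" "g ` A \<subseteq> B"
proof -
  have "emeasure \<mu> A < emeasure \<mu> B" if \<mu>: "\<mu> \<in> invariant_measures G" for \<mu>
  proof -
    interpret prob_space \<mu> by (rule invariant_measureD(1)[OF \<mu>])
    show ?thesis using less[OF \<mu>] by (simp add: emeasure_eq_measure ennreal_less_iff)
  qed
  then have "\<exists>U. compactin (arrows G) U \<and> openin (arrows G) U \<and> bisection G U \<and> src G ` U = A \<and> rng G ` U \<subseteq> B"
    using A B disj(2) by (intro comp[unfolded has_comparison_def, rule_format] conjI ballI)
  then obtain U where U: "compactin (arrows G) U" "openin (arrows G) U" "bisection G U"
    "src G ` U = A" "rng G ` U \<subseteq> B" by blast
  have "src G ` U \<inter> rng G ` U = {}" using U(4,5) disj(1) by blast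
  then obtain \<sigma> where \<sigma>: "\<sigma> \<in> carrier (full_group G)" "\<And>g. g \<in> U \<Longrightarrow> \<sigma> (src G g) = rng G g"
    using swap_of_bisection[OF U(1-3)] by blast
  have "\<sigma> ` A \<subseteq> B" using \<sigma>(2) U(4,5) by auto
  then show thesis using that \<sigma>(1) by blast
qed

theorem comparison_group_full_group:
  assumes min: "minimal_groupoid G" and comp: "has_comparison G"
  shows "comparison_group (full_group G) (units G) {A. clopenin (unit_space G) A}
    (measure ` invariant_measures G)"
proof -
  let ?T = "unit_space G" and ?C = "{A. clopenin (unit_space G) A}"
  have sub: "A \<subseteq> units G" if "clopenin ?T A" for A
    using that openin_subset[of ?T A] by (simp add: clopenin_def)
  have "comparison_group_axioms (full_group G) (units G) ?C (measure ` invariant_measures G)"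
  proof (rule comparison_group_axioms.intro)
    show "algebra (units G) ?C"
      unfolding algebra_iff_Int
    proof (intro conjI ballI)
      show "units G - A \<in> ?C" if "A \<in> ?C" for A
        using that openin_diff[OF openin_topspace, of ?T A] closedin_diff[OF closedin_topspace, of ?T A]
        by (simp add: clopenin_def)
      show "?C \<subseteq> Pow (units G)" using sub by blast
    qed (auto simp: clopenin_def)
    show "units G \<noteq> {}" using nonempty_units by simp
    show "\<exists>A \<in> ?C. x \<in> A \<and> y \<notin> A" if "x \<in> units G" "y \<in> units G" "x \<noteq> y" for x y
      using separated_units[of x y] that by auto
    show "\<exists>\<F>. finite \<F> \<and> \<F> \<subseteq> \<U> \<and> units G \<subseteq> \<Union> \<F>" if "\<U> \<subseteq> ?C" "units G \<subseteq> \<Union> \<U>" for \<U>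
    proof -
      have "compactin ?T (units G)" using compact_units by (simp add: compact_space_def)
      moreover have "\<forall>U \<in> \<U>. openin ?T U" using that(1) by (auto simp: clopenin_def)
      ultimately show ?thesis using that(2) unfolding compactin_def by meson
    qed
    show "\<exists>y \<in> A. y \<noteq> x" if "A \<in> ?C" "x \<in> A" for A x
      using perfect_units[of A x] that by (simp add: clopenin_def)
    show "f ` A \<in> ?C" if "f \<in> carrier (full_group G)" "A \<in> ?C" for f A
      using full_group_image_clopen that by simp
    show "f \<in> carrier (full_group G)"
      if "f \<in> Bij (units G)"
        "\<And>x. x \<in> units G \<Longrightarrow> \<exists>A \<in> ?C. x \<in> A \<and> (\<exists>g \<in> carrier (full_group G). \<forall>y \<in> A. f y = g y)" for f
      by (rule full_group_glue[OF that(1)]) (use that(2) in blast)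
    fix m assume "m \<in> measure ` invariant_measures G"
    then obtain \<mu> where \<mu>: "\<mu> \<in> invariant_measures G" and m: "m = measure \<mu>" by blast
    interpret prob_space \<mu> by (rule invariant_measureD(1)[OF \<mu>])
    show "0 \<le> m A" for A by (simp add: m)
    show "m (units G) = 1" using prob_space invariant_measureD(2)[OF \<mu>] by (simp add: m)
    show "m (A \<union> B) = m A + m B" if "A \<in> ?C" "B \<in> ?C" "A \<inter> B = {}" for A B
      using that clopen_sets[OF \<mu>] unfolding m by (intro finite_measure_Union) auto
    show "m (f ` A) = m A" if "f \<in> carrier (full_group G)" "A \<in> ?C" for f A
      using full_group_preserves_measure[OF \<mu> that(1), of A] that(2) by (simp add: m measure_def)
  next
    show "\<exists>g \<in> carrier (full_group G). g ` A \<subseteq> B"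
      if AB: "A \<in> ?C" "B \<in> ?C" "A \<inter> B = {}" "B \<noteq> {}"
        and less: "\<And>m. m \<in> measure ` invariant_measures G \<Longrightarrow> m A < m B" for A B
    proof -
      have "clopenin ?T A" "clopenin ?T B" using AB(1,2) by auto
      then obtain g where "g \<in> carrier (full_group G)" "g ` A \<subseteq> B"
        by (rule comparison_full_group[OF comp _ _ AB(3,4) less[OF imageI]])
      then show ?thesis by blast
    qed
    show "\<exists>V \<in> ?C. x \<in> V \<and> (\<forall>m \<in> measure ` invariant_measures G. m V \<le> m U)"
      if x: "x \<in> units G" and U: "U \<in> ?C" "U \<noteq> {}" for x U
    proof -
      have U': "clopenin ?T U" using U(1) by simp
      obtain V where "clopenin ?T V" "x \<in> V"
        "\<And>\<mu>. \<mu> \<in> invariant_measures G \<Longrightarrow> measure \<mu> V \<le> measure \<mu> U"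
        using minimal_subordinate[OF min x U' U(2)] by blast
      then show ?thesis by (intro bexI[of _ V]) auto
    qed
  qed
  then show ?thesis
    by (intro comparison_group.intro full.permutation_group_axioms)
qed

end


theorem theoremA:
  fixes G :: "'g top_groupoid"
  assumes "etale_groupoid G"
    and "second_countable (arrows G)"
    and "cantor_space (unit_space G)"
    and "minimal_groupoid G"
    and "has_comparison G"
  shows "is_simple (commutator_subgroup (full_group G))"
proof -
  interpret etale_groupoid G by (rule assms(1))
  interpret cantor_groupoid G by unfold_locales (rule assms(2,3))+
  interpret comparison_group "full_group G" "units G" "{A. clopenin (unit_space G) A}"
    "measure ` invariant_measures G"
    by (rule comparison_group_full_group[OF assms(4,5)])
  show ?thesis by (rule is_simple_commutator_subgroup)
qed

end
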